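(* Let $\mathbb H$ be a separable real Hilbert space, and let $\mathcal S_0$ be a countable symmetric subset (i.e. $\psi\in\mathcal S_0$ implies $-\psi\in\mathcal S_0$) dense in the unit sphere of $\mathbb H$. For every $N\ge2$, let $\Lambda_N$ be a finite index set; for each $\lambda\in\Lambda_N$, let $Z_\lambda$ be a measurable $\mathbb H$-valued random element, let $Z_\lambda^{(1)},\ldots,Z_\lambda^{(N)}$ be independent copies of $Z_\lambda$, and set $U_{N,\lambda}:=\frac1N\sum_{i=1}^N(Z_\lambda^{(i)}-\mathbb E[Z_\lambda])$. Assume that: (i) for some $r_0>2$ and $\mathrm C_{r_0}<\infty$ (not depending on $N$ or $\lambda$), and positive numbers $s_\lambda,v_\lambda$, for all $\lambda\in\Lambda_N$, $$\mathbb E[\|Z_\lambda\|_{\mathbb H}^2]\le s_\lambda^2,\qquad\sup_{\psi\in\mathcal S_0}\mathbb E[\langle Z_\lambda,\psi\rangle_{\mathbb H}^2]\le v_\lambda,\qquad\mathbb E[\|Z_\lambda\|_{\mathbb H}^{r_0}]\le\mathrm C_{r_0}s_\lambda^{r_0};$$ (ii) for some positive sequence $L_N$ and, for every $\mu>0$, a constant $\mathrm C_V(\mu)<\infty$ independent of $N$, $$\sum_{\lambda\in\Lambda_N}s_\lambda^2\le L_N,\qquad\sum_{\lambda\in\Lambda_N}v_\lambda\exp\Big(-\mu\frac{s_\lambda^2}{v_\lambda}\Big)\le\mathrm C_V(\mu).$$ Then, for every $\kappa\ge12$, there exists a finite constant $\mathrm C$, independent of $N$, such that $$\mathbb E\Big[\sup_{\lambda\in\Lambda_N}\Big(\|U_{N,\lambda}\|_{\mathbb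 H}^2-\frac{\kappa s_\lambda^2}{N}\Big)_+\Big]\le\mathrm C\Big\{\frac1N+\frac{L_N(\log N)^{r_0-2}}{N^{(r_0-2)/2}}\Big\}.$$ If, in addition, $\sup_{\lambda\in\Lambda_N}v_\lambda\le v_0<\infty$ (with $v_0$ independent of $N$), the second condition in (ii) may be replaced by $\sum_{\lambda\in\Lambda_N}e^{-\mu s_\lambda^2}\le\widetilde{\mathrm C}_V(\mu)$ for every $\mu>0$, with $\widetilde{\mathrm C}_V(\mu)$ independent of $N$.
   Context: $u_+:=\max\{u,0\}$. The bound is asserted for every $N\ge2$. $\mathbb E[Z_\lambda]$ is the Bochner expectation. *)

theory Defs
  imports "HOL-Probability.Probability"
begin

definition independent_copies ::
  "'a measure \<Rightarrow> nat \<Rightarrow> ('a \<Rightarrow> 'h::topological_space) \<Rightarrow> (nat \<Rightarrow> 'a \<Rightarrow> 'h) \<Rightarrow> bool" where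
  "independent_copies M n Z X \<longleftrightarrow>
     prob_space.indep_vars M (\<lambda>_. borel) X {1..n} \<and>
     (\<forall>i\<in>{1..n}. distr M borel (X i) = distr M borel Z)"

definition centred_mean ::
  "'a measure \<Rightarrow> nat \<Rightarrow> ('a \<Rightarrow> 'h::{real_inner, banach, second_countable_topology})
     \<Rightarrow> (nat \<Rightarrow> 'a \<Rightarrow> 'h) \<Rightarrow> 'a \<Rightarrow> 'h" where
  "centred_mean M n Z X \<omega> = (1 / real n) *\<^sub>R (\<Sum>i=1..n. (X i \<omega> - integral\<^sup>L M Z))"

text \<open>The expectation of a non-negative quantity is a non-negative integral: a Bochner integral
  would be 0 in the absence of integrability.  The supremum is taken in \<^typ>\<open>ennreal\<close>, so that
  it is 0 over an empty index set.\<close>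

definition expected_sup_excess ::
  "'a measure \<Rightarrow> 'l set \<Rightarrow> ('l \<Rightarrow> 'a \<Rightarrow> 'h::real_normed_vector) \<Rightarrow> ('l \<Rightarrow> real) \<Rightarrow> ennreal" where
  "expected_sup_excess M A U t =
     (\<integral>\<^sup>+ \<omega>. (SUP l\<in>A. ennreal (max ((norm (U l \<omega>))\<^sup>2 - t l) 0)) \<partial>M)"

end

theory Submission
  imports Defs
begin

text \<open>Standardise the summands to \<open>V = (Z - E Z) / s\<close> and put \<open>w = v / s\<^sup>2\<close>.  For \<open>V\<close> bounded by \<open>b\<close> and \<open>x\<close> in the
  ball of radius \<open>R\<close>, expanding the exponential to second order gives
  \<open>E exp (\<theta> |x + V|\<^sup>2) \<le> exp ((\<theta> + 8 w \<theta>\<^sup>2) |x|\<^sup>2 + 2 \<theta>)\<close>: only the weak variance \<open>w\<close> enters the factor of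
  \<open>|x|\<^sup>2\<close>.  With \<open>\<theta> = 1 / (32 w n)\<close> the exponent at most doubles over \<open>n\<close> steps, so the sum \<open>S\<close> satisfies
  \<open>E exp (\<theta> |S|\<^sup>2) \<le> exp (4 \<theta> n)\<close> as long as it stays in the ball, whence
  \<open>E (|S|\<^sup>2 - 12 n)\<^sub>+ \<le> exp (- 8 \<theta> n) / \<theta>\<close> on that event.  Leaving the ball is excluded up to a power of \<open>n\<close>
  by freezing the walk at its exit, and a summand exceeding \<open>b\<close>, of order \<open>n\<^sup>1\<^sup>/\<^sup>2 / ln n\<close>, costs the rate
  term by the moment assumption.  This replaces Talagrand's inequality; the supremum over the index set
  is then bounded by the sum.\<close>

section \<open>Elementary inequalities for the exponential and the norm\<close>

text \<open>For negative \<open>t\<close>, compare \<open>exp t <= 1 / (1 - t)\<close> with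
  \<open>(1 + t + t^2) * (1 - t) = 1 - t^3 >= 1\<close>. Only an upper bound on \<open>t\<close> is
  required, so the inner product in the exponent need not be bounded from below.\<close>

lemma exp_le_quadratic:
  fixes t :: real
  assumes "t \<le> 1"
  shows "exp t \<le> 1 + t + t\<^sup>2"
proof (cases "t \<ge> 0")
  case True
  then show ?thesis using assms exp_bound by blast
next
  case False
  have *: "1 / (1 - t) \<le> 1 + t + t\<^sup>2"
  proof -
    have "(1 + t + t\<^sup>2) * (1 - t) = 1 - t ^ 3"
      by (simp add: algebra_simps power2_eq_square power3_eq_cube)
    moreover have "t ^ 3 \<le> 0" using False by (simp add: power3_eq_cube mult_nonneg_nonpos2 mult_nonneg_nonpos mult_nonpos_nonpos)
    ultimately have "(1 + t + t\<^sup>2) * (1 - t) \<ge> 1" by simp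
    then show ?thesis using False by (simp add: divide_le_eq)
  qed
  have "1 - t \<le> exp (- t)" using exp_ge_add_one_self[of "-t"] by simp
  then have "exp t \<le> 1 / (1 - t)"
    using False by (simp add: exp_minus field_simps)
  with * show ?thesis by linarith
qed

text \<open>The increment of the exponent is \<open>u + z\<close> with
  \<open>u = 2 * \<theta> * (x \<bullet> y)\<close> and \<open>z = \<theta> * |y|^2\<close>. The two
  hypotheses on \<open>b\<close> make each at most 1/2, so the quadratic bound applies, and
  \<open>2 * z^2 <= z\<close> leaves \<open>1 + u + 2 * u^2 + 2 * z\<close>. The linear term in
  \<open>y\<close> is kept exactly, because it integrates to zero for a centred law.\<close>

lemma exp_norm_add_le:
  fixes x y :: "'h::real_inner"
  assumes \<theta>: "\<theta> > 0" and x: "norm x \<le> R" and y: "norm y \<le> b"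
    and Rb: "4 * \<theta> * R * b \<le> 1" and bb: "2 * \<theta> * b\<^sup>2 \<le> 1"
  shows "exp (\<theta> * (norm (x + y))\<^sup>2)
    \<le> exp (\<theta> * (norm x)\<^sup>2) * (1 + 2 * \<theta> * (x \<bullet> y) + 8 * \<theta>\<^sup>2 * (x \<bullet> y)\<^sup>2 + 2 * \<theta> * (norm y)\<^sup>2)"
proof -
  define u where "u = 2 * \<theta> * (x \<bullet> y)"
  define z where "z = \<theta> * (norm y)\<^sup>2"
  have z0: "z \<ge> 0" using \<theta> by (simp add: z_def)
  have "(norm y)\<^sup>2 \<le> b\<^sup>2" using y by (simp add: power_mono)
  then have "2 * \<theta> * (norm y)\<^sup>2 \<le> 2 * \<theta> * b\<^sup>2" using \<theta> by simp
  then have z2: "2 * z \<le> 1" using bb by (simp add: z_def)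
  have "x \<bullet> y \<le> norm x * norm y" by (rule norm_cauchy_schwarz)
  also have "\<dots> \<le> R * b" using x y by (intro mult_mono) (auto intro: order_trans[OF norm_ge_zero])
  finally have "4 * \<theta> * (x \<bullet> y) \<le> 4 * \<theta> * (R * b)" using \<theta> by simp
  then have u1: "2 * u \<le> 1" using Rb by (simp add: u_def algebra_simps)
  have "(u + z)\<^sup>2 \<le> 2 * u\<^sup>2 + 2 * z\<^sup>2"
    using zero_le_power2[of "u - z"] by (simp add: power2_eq_square algebra_simps)
  moreover have "2 * z\<^sup>2 \<le> z" using mult_right_mono[OF z2 z0] by (simp add: power2_eq_square)
  moreover have "exp (u + z) \<le> 1 + (u + z) + (u + z)\<^sup>2"
    using u1 z2 by (intro exp_le_quadratic) simp
  ultimately have *: "exp (u + z) \<le> 1 + u + 2 * u\<^sup>2 + 2 * z" by linarith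
  have "\<theta> * (norm (x + y))\<^sup>2 = \<theta> * (norm x)\<^sup>2 + (u + z)"
    by (simp add: u_def z_def power2_norm_eq_inner inner_add_left inner_add_right inner_commute algebra_simps)
  then have "exp (\<theta> * (norm (x + y))\<^sup>2) = exp (\<theta> * (norm x)\<^sup>2) * exp (u + z)"
    by (simp add: exp_add)
  also have "\<dots> \<le> exp (\<theta> * (norm x)\<^sup>2) * (1 + u + 2 * u\<^sup>2 + 2 * z)"
    using * by simp
  finally show ?thesis by (simp add: u_def z_def power_mult_distrib mult.assoc)
qed

lemma norm_add_sq_le:
  fixes x y :: "'h::real_inner"
  shows "(norm (x + y))\<^sup>2 \<le> 2 * (norm x)\<^sup>2 + 2 * (norm y)\<^sup>2"
  using zero_le_power2[of "norm (x - y)"]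
  by (simp add: power2_norm_eq_inner inner_add_left inner_add_right inner_diff_left inner_diff_right inner_commute)

lemma (in finite_measure) integrable_of_integrable_norm_sq:
  fixes f :: "'a \<Rightarrow> 'h::{banach, second_countable_topology}"
  assumes f: "f \<in> borel_measurable M" and int: "integrable M (\<lambda>x. (norm (f x))\<^sup>2)"
  shows "integrable M f"
proof (rule Bochner_Integration.integrable_bound[OF _ f])
  show "integrable M (\<lambda>x. 1 + (norm (f x))\<^sup>2)" using int by simp
  show "AE x in M. norm (f x) \<le> norm (1 + (norm (f x))\<^sup>2)"
  proof (rule AE_I2)
    fix x
    have "norm (f x) \<le> 1 + (norm (f x))\<^sup>2"
      using zero_le_power2[of "norm (f x) - 1"] zero_le_power2[of "norm (f x)"] norm_ge_zero[of "f x"]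
      unfolding power2_diff power_one mult_1_right by linarith
    then show "norm (f x) \<le> norm (1 + (norm (f x))\<^sup>2)" by simp
  qed
qed

section \<open>One-step estimates for a standardised law\<close>

text \<open>\<open>D\<close> is the law of a standardised summand, with strong second moment at most
  1. The parameter \<open>w\<close> is only an upper bound for the weak variance, hence it may be
  enlarged; \<open>excess_bound\<close> relies on this.\<close>

locale normalized_law = prob_space D
  for D :: "'h::{real_inner, banach, second_countable_topology} measure" +
  fixes w r c :: real
  assumes sets_D [measurable_cong, simp]: "sets D = sets borel"
    and w_pos: "w > 0" and r_gt: "r > 2"
    and integrable_sq: "integrable D (\<lambda>y. (norm y)\<^sup>2)"
    and mean_zero: "(\<integral>y. y \<partial>D) = 0"
    and sq_le: "(\<integral>y. (norm y)\<^sup>2 \<partial>D) \<le> 1"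
    and c_nonneg: "c \<ge> 0"
    and weak_le: "\<And>x. (\<integral>y. (x \<bullet> y)\<^sup>2 \<partial>D) \<le> w * (norm x)\<^sup>2"
    and moment_le: "(\<integral>\<^sup>+ y. ennreal (norm y powr r) \<partial>D) \<le> ennreal c"
begin

lemma space_D [simp]: "space D = UNIV"
  using sets_eq_imp_space_eq[OF sets_D] by simp

lemma prob_UNIV [simp]: "prob UNIV = 1"
  using prob_space by simp

lemma integrable_id: "integrable D (\<lambda>y. y)"
  by (rule integrable_of_integrable_norm_sq[OF _ integrable_sq]) measurable

lemma integral_inner [simp]: "(\<integral>y. x \<bullet> y \<partial>D) = 0"
  using integral_inner_right[where c = x and M = D and f = "\<lambda>y. y"] integrable_id mean_zero by simp

lemma integrable_inner: "integrable D (\<lambda>y. x \<bullet> y)"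
  using integrable_id by simp

lemma integrable_inner_sq: "integrable D (\<lambda>y. (x \<bullet> y)\<^sup>2)"
proof (rule Bochner_Integration.integrable_bound)
  show "integrable D (\<lambda>y. (norm x)\<^sup>2 * (norm y)\<^sup>2)" using integrable_sq by simp
  show "AE y in D. norm ((x \<bullet> y)\<^sup>2) \<le> norm ((norm x)\<^sup>2 * (norm y)\<^sup>2)"
    using Cauchy_Schwarz_ineq[of x] by (simp add: power2_norm_eq_inner)
qed measurable

text \<open>Integrating the quadratic majorant removes the linear term by centring, bounds the
  squared inner product by \<open>w * |x|^2\<close>, and bounds the last term by
  \<open>2 * \<theta>\<close>; then \<open>1 + a <= exp a\<close>. The strong second moment thus
  enters only additively.\<close>

lemma nn_integral_exp_step:
  assumes \<theta>: "\<theta> > 0" and x: "norm x \<le> R"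
    and Rb: "4 * \<theta> * R * b \<le> 1" and bb: "2 * \<theta> * b\<^sup>2 \<le> 1"
  shows "(\<integral>\<^sup>+ y. ennreal (exp (\<theta> * (norm (x + y))\<^sup>2)) * indicator {y. norm y \<le> b} y \<partial>D)
    \<le> ennreal (exp ((\<theta> + 8 * \<theta>\<^sup>2 * w) * (norm x)\<^sup>2 + 2 * \<theta>))"
proof -
  define q where "q y = 1 + 2 * \<theta> * (x \<bullet> y) + 8 * \<theta>\<^sup>2 * (x \<bullet> y)\<^sup>2 + 2 * \<theta> * (norm y)\<^sup>2" for y
  \<comment> \<open>Nonnegativity turns the nonnegative integral of the majorant into a Bochner
    integral, in which centring can be used. With \<open>u = 2 * \<theta> * (x \<bullet> y)\<close>
    it follows by completing a square.\<close>
  have q0: "q y \<ge> 0" for y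
  proof -
    have "q y = (1 + 2 * \<theta> * (x \<bullet> y) + 2 * (2 * \<theta> * (x \<bullet> y))\<^sup>2) + 2 * \<theta> * (norm y)\<^sup>2"
      by (simp add: q_def power_mult_distrib)
    moreover have "1 + u + 2 * u\<^sup>2 \<ge> 0" for u :: real
    proof -
      have "1 + u + 2 * u\<^sup>2 = (u + 1 / 2)\<^sup>2 + u\<^sup>2 + 3 / 4"
        by (simp add: power2_eq_square field_simps)
      moreover have "0 \<le> (u + 1 / 2)\<^sup>2 + u\<^sup>2 + 3 / 4" by (intro add_nonneg_nonneg) simp_all
      ultimately show ?thesis by linarith
    qed
    ultimately show ?thesis using \<theta> by simp
  qed
  have int: "integrable D q"
    unfolding q_def using integrable_inner integrable_inner_sq integrable_sq by simp
  have "(\<integral>y. q y \<partial>D) = 1 + 8 * \<theta>\<^sup>2 * (\<integral>y. (x \<bullet> y)\<^sup>2 \<partial>D) + 2 * \<theta> * (\<integral>y. (norm y)\<^sup>2 \<partial>D)"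
    unfolding q_def using integrable_inner integrable_inner_sq integrable_sq
    by (simp add: prob_space)
  also have "\<dots> \<le> 1 + 8 * \<theta>\<^sup>2 * (w * (norm x)\<^sup>2) + 2 * \<theta> * 1"
    using weak_le[of x] sq_le \<theta> by (intro add_mono mult_left_mono) auto
  also have "\<dots> = 1 + (8 * \<theta>\<^sup>2 * w * (norm x)\<^sup>2 + 2 * \<theta>)" by simp
  also have "\<dots> \<le> exp (8 * \<theta>\<^sup>2 * w * (norm x)\<^sup>2 + 2 * \<theta>)" by (rule exp_ge_add_one_self)
  finally have Iq: "(\<integral>y. q y \<partial>D) \<le> exp (8 * \<theta>\<^sup>2 * w * (norm x)\<^sup>2 + 2 * \<theta>)" .
  have "(\<integral>\<^sup>+ y. ennreal (exp (\<theta> * (norm (x + y))\<^sup>2)) * indicator {y. norm y \<le> b} y \<partial>D)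
      \<le> (\<integral>\<^sup>+ y. ennreal (exp (\<theta> * (norm x)\<^sup>2) * q y) \<partial>D)"
    using exp_norm_add_le[OF \<theta> x _ Rb bb]
    by (intro nn_integral_mono) (auto simp: q_def split: split_indicator intro!: ennreal_leI)
  also have "\<dots> = ennreal (exp (\<theta> * (norm x)\<^sup>2) * (\<integral>y. q y \<partial>D))"
    using int q0 by (subst nn_integral_eq_integral) auto
  also have "\<dots> \<le> ennreal (exp (\<theta> * (norm x)\<^sup>2) * exp (8 * \<theta>\<^sup>2 * w * (norm x)\<^sup>2 + 2 * \<theta>))"
    using Iq by (intro ennreal_leI) simp
  finally show ?thesis by (simp add: exp_add[symmetric] algebra_simps)
qed

lemma nn_integral_norm_add_sq:
  "(\<integral>\<^sup>+ y. ennreal ((norm (x + y))\<^sup>2) \<partial>D) \<le> ennreal ((norm x)\<^sup>2) + 1"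
proof -
  have eq: "(norm (x + y))\<^sup>2 = (norm x)\<^sup>2 + 2 * (x \<bullet> y) + (norm y)\<^sup>2" for y
    by (simp add: power2_norm_eq_inner inner_add_left inner_add_right inner_commute)
  have "integrable D (\<lambda>y. (norm (x + y))\<^sup>2)"
    unfolding eq using integrable_inner integrable_sq by simp
  then have "(\<integral>\<^sup>+ y. ennreal ((norm (x + y))\<^sup>2) \<partial>D) = ennreal (\<integral>y. (norm (x + y))\<^sup>2 \<partial>D)"
    by (intro nn_integral_eq_integral) auto
  also have "(\<integral>y. (norm (x + y))\<^sup>2 \<partial>D) \<le> (norm x)\<^sup>2 + 1"
    unfolding eq using integrable_inner integrable_sq sq_le by (simp add: prob_space)
  finally show ?thesis by (simp add: ennreal_leI)
qed

end

section \<open>The walk frozen on leaving a ball\<close>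

text \<open>The increment that leads out of the ball is still added, and the walk is frozen
  afterwards. The final value therefore lies outside the ball exactly when the walk left it at some
  time.\<close>

primrec stopped_sum :: "real \<Rightarrow> (nat \<Rightarrow> 'h::real_normed_vector) \<Rightarrow> nat \<Rightarrow> 'h" where
  "stopped_sum R \<xi> 0 = 0"
| "stopped_sum R \<xi> (Suc k) =
    (if norm (stopped_sum R \<xi> k) \<le> R then stopped_sum R \<xi> k + \<xi> (Suc k) else stopped_sum R \<xi> k)"

lemma stopped_sum_upd: "k < j \<Longrightarrow> stopped_sum R (\<xi>(j := y)) k = stopped_sum R \<xi> k"
  by (induction k) auto

text \<open>A frozen walk never returns to the ball, so ending inside means that no increment was
  skipped.\<close>

lemma stopped_sum_eq_sum:
  "norm (stopped_sum R \<xi> k) \<le> R \<Longrightarrow> stopped_sum R \<xi> k = (\<Sum>i=1..k. \<xi> i)"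
  by (induction k) (auto split: if_splits simp: add.commute)

context normalized_law
begin

lemma measurable_coordinate:
  "i \<in> I \<Longrightarrow> (\<lambda>\<xi>. \<xi> i) \<in> borel_measurable (PiM I (\<lambda>_. D))"
  using measurable_component_singleton[of i I "\<lambda>_. D"] by simp

lemma measurable_stopped_sum:
  "{1..k} \<subseteq> I \<Longrightarrow> (\<lambda>\<xi>. stopped_sum R \<xi> k) \<in> borel_measurable (PiM I (\<lambda>_. D))"
proof (induction k)
  case (Suc k)
  have [measurable]: "(\<lambda>\<xi>. stopped_sum R \<xi> k) \<in> borel_measurable (PiM I (\<lambda>_. D))"
    using Suc by (auto simp: atLeastAtMostSuc_conv)
  have [measurable]: "(\<lambda>\<xi>. \<xi> (Suc k)) \<in> borel_measurable (PiM I (\<lambda>_. D))"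
    using Suc.prems by (intro measurable_coordinate) auto
  show ?case by simp
qed simp

lemma bounded_event_measurable:
  "finite J \<Longrightarrow> J \<subseteq> I \<Longrightarrow>
    (indicator {\<xi>. \<forall>i\<in>J. norm (\<xi> i) \<le> b} :: _ \<Rightarrow> ennreal) \<in> borel_measurable (PiM I (\<lambda>_. D))"
proof -
  assume J: "finite J" "J \<subseteq> I"
  have eq: "(indicator {\<xi>. \<forall>i\<in>J. norm (\<xi> i) \<le> b} :: (_ \<Rightarrow> 'h) \<Rightarrow> ennreal)
      = (\<lambda>\<xi>. \<Prod>i\<in>J. indicator {y. norm y \<le> b} (\<xi> i))"
    using J(1) by (induction J rule: finite_induct) (auto split: split_indicator simp: fun_eq_iff)
  moreover have "(\<lambda>\<xi>. \<Prod>i\<in>J. indicator {y. norm y \<le> b} (\<xi> i) :: ennreal) \<in> borel_measurable (PiM I (\<lambda>_. D))"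
  proof (intro borel_measurable_prod_ennreal)
    fix i assume "i \<in> J"
    then have [measurable]: "(\<lambda>\<xi>. \<xi> i) \<in> borel_measurable (PiM I (\<lambda>_. D))"
      using J by (intro measurable_coordinate) auto
    show "(\<lambda>\<xi>. indicator {y. norm y \<le> b} (\<xi> i) :: ennreal) \<in> borel_measurable (PiM I (\<lambda>_. D))"
      by simp
  qed
  ultimately show ?thesis by (simp only: eq)
qed

lemma measurable_exp_stopped_sum:
  assumes I: "{1..k} \<subseteq> I"
  shows "(\<lambda>\<xi>. ennreal (exp (a * (norm (stopped_sum R \<xi> k))\<^sup>2))
      * indicator {\<xi>. \<forall>i\<in>{1..k}. norm (\<xi> i) \<le> b} \<xi>) \<in> borel_measurable (PiM I (\<lambda>_. D))"
proof (rule borel_measurable_times_ennreal)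
  have [measurable]: "(\<lambda>\<xi>. stopped_sum R \<xi> k) \<in> borel_measurable (PiM I (\<lambda>_. D))"
    by (rule measurable_stopped_sum[OF I])
  show "(\<lambda>\<xi>. ennreal (exp (a * (norm (stopped_sum R \<xi> k))\<^sup>2))) \<in> borel_measurable (PiM I (\<lambda>_. D))"
    by measurable
qed (rule bounded_event_measurable[OF _ I], simp)

text \<open>A supermartingale argument, by integrating out the last coordinate. The coefficient
  \<open>\<theta> * (2 - k / n)\<close> falls from \<open>2 * \<theta>\<close> to
  \<open>\<theta>\<close> in the course of \<open>n\<close> steps, and each decrement pays for the
  growth of the factor of \<open>|x|^2\<close> in the one-step bound. What remains is a factor of at
  most \<open>exp (4 * \<theta>)\<close> per step.\<close>

lemma nn_integral_exp_stopped_sum: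
  assumes n: "n > 0" and R: "R \<ge> 0"
    and Rb: "R * b \<le> 4 * w * real n" and bb: "b\<^sup>2 \<le> 8 * w * real n"
    and \<theta>: "\<theta> = 1 / (32 * w * real n)" and k: "k \<le> n"
  shows "(\<integral>\<^sup>+ \<xi>. ennreal (exp (\<theta> * (2 - real k / real n) * (norm (stopped_sum R \<xi> k))\<^sup>2))
        * indicator {\<xi>. \<forall>i\<in>{1..k}. norm (\<xi> i) \<le> b} \<xi> \<partial>PiM {1..k} (\<lambda>_. D))
    \<le> ennreal (exp (4 * \<theta> * real k))"
  using k
proof (induction k)
  case 0
  show ?case by (simp add: PiM_empty nn_integral_count_space_finite)
next
  case (Suc k)
  interpret P: product_prob_space "\<lambda>_::nat. D" "{1..k}" ..
  define \<theta>1 where "\<theta>1 = \<theta> * (2 - real (Suc k) / real n)"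
  define \<theta>0 where "\<theta>0 = \<theta> * (2 - real k / real n)"
  have \<theta>_pos: "\<theta> > 0" using w_pos n by (simp add: \<theta>)
  have "real (Suc k) / real n \<le> 1" "real (Suc k) / real n \<ge> 0" using Suc.prems n by auto
  then have \<theta>1: "\<theta>1 > 0" "\<theta>1 \<le> 2 * \<theta>" using \<theta>_pos by (auto simp: \<theta>1_def)
  \<comment> \<open>This identity dictates the value of \<open>\<theta>\<close>: the decrement
    \<open>\<theta> / n\<close> of the coefficient must equal
    \<open>8 * w * (2 * \<theta>)^2\<close>, which dominates the growth
    \<open>8 * w * \<theta>1^2\<close>.\<close>
  have "32 * w * \<theta>\<^sup>2 = \<theta> / real n" using w_pos n by (simp add: \<theta> power2_eq_square)
  then have \<theta>0_eq: "\<theta>0 = \<theta>1 + 32 * w * \<theta>\<^sup>2"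
    using n by (simp add: \<theta>0_def \<theta>1_def field_simps)
  have "\<theta>1\<^sup>2 \<le> (2 * \<theta>)\<^sup>2" using \<theta>1 by (intro power_mono) auto
  then have "8 * w * \<theta>1\<^sup>2 \<le> 8 * w * (2 * \<theta>)\<^sup>2" using w_pos by simp
  then have \<theta>01: "\<theta>1 + 8 * \<theta>1\<^sup>2 * w \<le> \<theta>0" "\<theta>1 \<le> \<theta>0"
    using w_pos by (auto simp: \<theta>0_eq power_mult_distrib algebra_simps)
  \<comment> \<open>The hypotheses on \<open>R * b\<close> and \<open>b^2\<close> are calibrated so
    that replacing \<open>\<theta>1\<close> by \<open>2 * \<theta>\<close> gives exactly 1 in both
    smallness conditions of the one-step bound. The sign of \<open>b\<close> is not assumed, whence
    the case split.\<close>
  have c1: "4 * \<theta>1 * R * b \<le> 1"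
  proof (cases "b \<ge> 0")
    case True
    then have "4 * \<theta>1 * (R * b) \<le> 4 * (2 * \<theta>) * (4 * w * real n)"
      using \<theta>1 R Rb \<theta>_pos by (intro mult_mono[of "4 * \<theta>1"]) auto
    also have "\<dots> = 1" using w_pos n by (simp add: \<theta>)
    finally show ?thesis by (simp add: mult.assoc)
  next
    case False
    then have "4 * \<theta>1 * R * b \<le> 0" using \<theta>1 R by (intro mult_nonneg_nonpos) auto
    then show ?thesis by linarith
  qed
  have "2 * \<theta>1 * b\<^sup>2 \<le> 2 * (2 * \<theta>) * (8 * w * real n)"
    using \<theta>1 bb \<theta>_pos by (intro mult_mono) auto
  also have "\<dots> = 1" using w_pos n by (simp add: \<theta>)
  finally have c2: "2 * \<theta>1 * b\<^sup>2 \<le> 1" .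
  define F where "F \<xi> = ennreal (exp (\<theta>1 * (norm (stopped_sum R \<xi> (Suc k)))\<^sup>2))
        * indicator {\<xi>. \<forall>i\<in>{1..Suc k}. norm (\<xi> i) \<le> b} \<xi>" for \<xi> :: "nat \<Rightarrow> 'h"
  define G where "G \<xi> = ennreal (exp (\<theta>0 * (norm (stopped_sum R \<xi> k))\<^sup>2))
        * indicator {\<xi>. \<forall>i\<in>{1..k}. norm (\<xi> i) \<le> b} \<xi>" for \<xi> :: "nat \<Rightarrow> 'h"
  have ins: "insert (Suc k) {1..k} = {1..Suc k}" by (simp add: atLeastAtMostSuc_conv)
  have F_meas: "F \<in> borel_measurable (PiM {1..Suc k} (\<lambda>_. D))"
    unfolding F_def by (rule measurable_exp_stopped_sum) simp
  have [measurable]: "G \<in> borel_measurable (PiM {1..k} (\<lambda>_. D))"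
    unfolding G_def by (rule measurable_exp_stopped_sum) simp
  \<comment> \<open>The first \<open>k\<close> coordinates are fixed. Either one of them exceeds
    \<open>b\<close> and the integrand vanishes, or the walk is still in the ball and the one-step
    bound applies, or it is already frozen.\<close>
  have step: "(\<integral>\<^sup>+ y. F (\<xi>(Suc k := y)) \<partial>D) \<le> G \<xi> * ennreal (exp (4 * \<theta>))" for \<xi>
  proof (cases "\<forall>i\<in>{1..k}. norm (\<xi> i) \<le> b")
    case False
    then obtain i where "i \<in> {1..Suc k}" "i \<noteq> Suc k" "\<not> norm (\<xi> i) \<le> b" by fastforce
    then have "\<xi>(Suc k := y) \<notin> {\<xi>. \<forall>i\<in>{1..Suc k}. norm (\<xi> i) \<le> b}" for y
      by (auto intro!: bexI[of _ i])
    then have "F (\<xi>(Suc k := y)) = 0" for y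
      by (simp add: F_def)
    then show ?thesis by simp
  next
    case True
    let ?x = "stopped_sum R \<xi> k"
    have ind: "indicator {\<xi>. \<forall>i\<in>{1..Suc k}. norm (\<xi> i) \<le> b} (\<xi>(Suc k := y))
        = (indicator {y. norm y \<le> b} y :: ennreal)" for y
      using True by (auto simp: atLeastAtMostSuc_conv split: split_indicator)
    have "(\<integral>\<^sup>+ y. F (\<xi>(Suc k := y)) \<partial>D) \<le> ennreal (exp (\<theta>0 * (norm ?x)\<^sup>2 + 4 * \<theta>))"
    proof (cases "norm ?x \<le> R")
      case True
      have "(\<integral>\<^sup>+ y. F (\<xi>(Suc k := y)) \<partial>D)
          = (\<integral>\<^sup>+ y. ennreal (exp (\<theta>1 * (norm (?x + y))\<^sup>2)) * indicator {y. norm y \<le> b} y \<partial>D)"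
        unfolding F_def ind using True by (simp add: stopped_sum_upd)
      also have "\<dots> \<le> ennreal (exp ((\<theta>1 + 8 * \<theta>1\<^sup>2 * w) * (norm ?x)\<^sup>2 + 2 * \<theta>1))"
        by (rule nn_integral_exp_step[OF \<theta>1(1) True c1 c2])
      also have "\<dots> \<le> ennreal (exp (\<theta>0 * (norm ?x)\<^sup>2 + 4 * \<theta>))"
        using \<theta>1(2) \<theta>01(1) by (intro ennreal_leI iffD2[OF exp_le_cancel_iff] add_mono mult_right_mono) auto
      finally show ?thesis .
    next
      \<comment> \<open>For a frozen walk the new coordinate has no effect on the norm, and the
        exponent only drops because \<open>\<theta>1 <= \<theta>0\<close>.\<close>
      case False
      have "(\<integral>\<^sup>+ y. F (\<xi>(Suc k := y)) \<partial>D) \<le> (\<integral>\<^sup>+ y. ennreal (exp (\<theta>0 * (norm ?x)\<^sup>2 + 4 * \<theta>)) \<partial>D)"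
      proof (intro nn_integral_mono)
        fix y
        have "\<theta>1 * (norm ?x)\<^sup>2 \<le> \<theta>0 * (norm ?x)\<^sup>2 + 4 * \<theta>"
          using \<theta>01(2) \<theta>_pos mult_right_mono[OF \<theta>01(2), of "(norm ?x)\<^sup>2"] by simp
        then show "F (\<xi>(Suc k := y)) \<le> ennreal (exp (\<theta>0 * (norm ?x)\<^sup>2 + 4 * \<theta>))"
          unfolding F_def ind using False
          by (auto simp: stopped_sum_upd split: split_indicator intro!: ennreal_leI)
      qed
      also have "\<dots> = ennreal (exp (\<theta>0 * (norm ?x)\<^sup>2 + 4 * \<theta>))"
        using emeasure_space_1 by simp
      finally show ?thesis .
    qed
    also have "\<dots> = G \<xi> * ennreal (exp (4 * \<theta>))"
      using True by (simp add: G_def exp_add ennreal_mult)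
    finally show ?thesis .
  qed
  have "(\<integral>\<^sup>+ \<xi>. F \<xi> \<partial>PiM {1..Suc k} (\<lambda>_. D))
      = (\<integral>\<^sup>+ \<xi>. (\<integral>\<^sup>+ y. F (\<xi>(Suc k := y)) \<partial>D) \<partial>PiM {1..k} (\<lambda>_. D))"
    by (rule P.product_nn_integral_insert[of "{1..k}" "Suc k" F, unfolded ins, OF _ _ F_meas]) auto
  also have "\<dots> \<le> (\<integral>\<^sup>+ \<xi>. G \<xi> * ennreal (exp (4 * \<theta>)) \<partial>PiM {1..k} (\<lambda>_. D))"
    by (intro nn_integral_mono step)
  also have "\<dots> = (\<integral>\<^sup>+ \<xi>. G \<xi> \<partial>PiM {1..k} (\<lambda>_. D)) * ennreal (exp (4 * \<theta>))"
    by (rule nn_integral_multc) measurable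
  also have "\<dots> \<le> ennreal (exp (4 * \<theta> * real k)) * ennreal (exp (4 * \<theta>))"
    using Suc unfolding G_def \<theta>0_def by (intro mult_right_mono) auto
  also have "\<dots> = ennreal (exp (4 * \<theta> * real (Suc k)))"
    by (simp add: ennreal_mult[symmetric] exp_add[symmetric] algebra_simps)
  finally show ?case unfolding F_def \<theta>1_def .
qed

section \<open>Second moments and the contribution of large summands\<close>

text \<open>Independent centred summands are orthogonal, so each adds at most 1. The index set is
  arbitrary because the bound is later applied after removing one coordinate.\<close>

lemma nn_integral_norm_sum_sq:
  assumes "finite I"
  shows "(\<integral>\<^sup>+ \<xi>. ennreal ((norm (\<Sum>i\<in>I. \<xi> i))\<^sup>2) \<partial>PiM I (\<lambda>_::nat. D)) \<le> ennreal (real (card I))"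
  using assms
proof (induction I rule: finite_induct)
  case empty
  show ?case by (simp add: PiM_empty)
next
  case (insert i I)
  interpret P: product_prob_space "\<lambda>_::nat. D" I ..
  have upd: "(\<Sum>j\<in>insert i I. (\<xi>(i := y)) j) = (\<Sum>j\<in>I. \<xi> j) + y" for \<xi> :: "nat \<Rightarrow> 'h" and y
  proof -
    have "(\<Sum>j\<in>I. (\<xi>(i := y)) j) = (\<Sum>j\<in>I. \<xi> j)" using insert.hyps by (intro sum.cong) auto
    then show ?thesis using insert.hyps by (simp add: add.commute)
  qed
  have "(\<integral>\<^sup>+ \<xi>. ennreal ((norm (\<Sum>j\<in>insert i I. \<xi> j))\<^sup>2) \<partial>PiM (insert i I) (\<lambda>_. D))
    = (\<integral>\<^sup>+ \<xi>. (\<integral>\<^sup>+ y. ennreal ((norm ((\<Sum>j\<in>I. \<xi> j) + y))\<^sup>2) \<partial>D) \<partial>PiM I (\<lambda>_. D))"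
    by (subst P.product_nn_integral_insert[OF insert.hyps]) (simp_all only: upd, measurable)
  also have "\<dots> \<le> (\<integral>\<^sup>+ \<xi>. ennreal ((norm (\<Sum>j\<in>I. \<xi> j))\<^sup>2) + 1 \<partial>PiM I (\<lambda>_. D))"
    by (intro nn_integral_mono nn_integral_norm_add_sq)
  also have "\<dots> = (\<integral>\<^sup>+ \<xi>. ennreal ((norm (\<Sum>j\<in>I. \<xi> j))\<^sup>2) \<partial>PiM I (\<lambda>_. D)) + 1"
    using P.emeasure_space_1 by (subst nn_integral_add) auto
  also have "\<dots> \<le> ennreal (real (card I)) + 1" using insert.IH by (intro add_mono) auto
  also have "\<dots> = ennreal (real (card I) + 1)"
    by (subst ennreal_plus) auto
  also have "real (card I) + 1 = real (card (insert i I))"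
    using insert.hyps by simp
  finally show ?case .
qed

text \<open>Markov's inequality for the moment of order \<open>r\<close>.\<close>

lemma emeasure_tail_le:
  assumes b: "b > 0"
  shows "emeasure D {y. b < norm y} \<le> ennreal (c * b powr - r)"
proof -
  have "emeasure D {y. b < norm y} = (\<integral>\<^sup>+ y. indicator {y. b < norm y} y \<partial>D)"
    by (intro nn_integral_indicator[symmetric]) simp
  also have "\<dots> \<le> (\<integral>\<^sup>+ y. ennreal (norm y powr r) * ennreal (b powr - r) \<partial>D)"
  proof (intro nn_integral_mono)
    fix y :: 'h
    have "1 \<le> norm y powr r * b powr - r" if "b < norm y"
    proof -
      have "b powr r \<le> norm y powr r" using b that r_gt by (intro powr_mono2) auto
      moreover have "b powr r > 0" using b by simp
      ultimately show ?thesis by (simp add: powr_minus_divide)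
    qed
    then show "indicator {y. b < norm y} y \<le> ennreal (norm y powr r) * ennreal (b powr - r)"
      by (auto simp: ennreal_mult[symmetric] split: split_indicator)
  qed
  also have "\<dots> = (\<integral>\<^sup>+ y. ennreal (norm y powr r) \<partial>D) * ennreal (b powr - r)"
    by (rule nn_integral_multc) measurable
  also have "\<dots> \<le> ennreal c * ennreal (b powr - r)"
    using moment_le by (intro mult_right_mono) auto
  finally show ?thesis using c_nonneg by (simp add: ennreal_mult)
qed

text \<open>Since \<open>r > 2\<close>, the factor \<open>norm y powr (2 - r)\<close> is decreasing
  in \<open>norm y\<close> and may be frozen at its value at \<open>b\<close>.\<close>

lemma nn_integral_sq_tail_le:
  assumes b: "b > 0"
  shows "(\<integral>\<^sup>+ y. ennreal ((norm y)\<^sup>2) * indicator {y. b < norm y} y \<partial>D) \<le> ennreal (c * b powr (2 - r))"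
proof -
  have "(\<integral>\<^sup>+ y. ennreal ((norm y)\<^sup>2) * indicator {y. b < norm y} y \<partial>D)
      \<le> (\<integral>\<^sup>+ y. ennreal (norm y powr r) * ennreal (b powr (2 - r)) \<partial>D)"
  proof (intro nn_integral_mono)
    fix y :: 'h
    have "(norm y)\<^sup>2 \<le> norm y powr r * b powr (2 - r)" if y: "b < norm y"
    proof -
      have "(norm y)\<^sup>2 = norm y powr r * norm y powr (2 - r)"
        using b y by (simp add: powr_add[symmetric])
      also have "\<dots> \<le> norm y powr r * b powr (2 - r)"
        using b y r_gt powr_mono2'[of "2 - r" b "norm y"] by (intro mult_left_mono) auto
      finally show ?thesis .
    qed
    then show "ennreal ((norm y)\<^sup>2) * indicator {y. b < norm y} y \<le> ennreal (norm y powr r) * ennreal (b powr (2 - r))"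
      by (auto simp: ennreal_mult[symmetric] split: split_indicator intro!: ennreal_leI)
  qed
  also have "\<dots> = (\<integral>\<^sup>+ y. ennreal (norm y powr r) \<partial>D) * ennreal (b powr (2 - r))"
    by (rule nn_integral_multc) measurable
  also have "\<dots> \<le> ennreal c * ennreal (b powr (2 - r))"
    using moment_le by (intro mult_right_mono) auto
  finally show ?thesis using c_nonneg by (simp add: ennreal_mult)
qed

text \<open>Coordinate \<open>i\<close> is split off from the rest, which is independent of it. In
  \<open>|x + y|^2 <= 2 * |x|^2 + 2 * |y|^2\<close> the first term produces the second moment of the
  rest times the tail probability, the second the truncated second moment of a single
  summand.\<close>

lemma nn_integral_norm_sum_sq_large:
  assumes I: "finite I" "i \<in> I" and b: "b > 0"
  shows "(\<integral>\<^sup>+ \<xi>. ennreal ((norm (\<Sum>j\<in>I. \<xi> j))\<^sup>2) * indicator {y. b < norm y} (\<xi> i) \<partial>PiM I (\<lambda>_::nat. D))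
    \<le> ennreal (2 * real (card I) * c * b powr - r + 2 * c * b powr (2 - r))"
proof -
  define J where "J = I - {i}"
  have J: "finite J" "i \<notin> J" and IJ: "I = insert i J" using I by (auto simp: J_def)
  interpret P: product_prob_space "\<lambda>_::nat. D" J ..
  let ?t = "indicator {y. b < norm y} :: 'h \<Rightarrow> ennreal"
  have upd: "(\<Sum>j\<in>insert i J. (\<xi>(i := y)) j) = (\<Sum>j\<in>J. \<xi> j) + y" for \<xi> :: "nat \<Rightarrow> 'h" and y
  proof -
    have "(\<Sum>j\<in>J. (\<xi>(i := y)) j) = (\<Sum>j\<in>J. \<xi> j)" using J by (intro sum.cong) auto
    then show ?thesis using J by (simp add: add.commute)
  qed
  have inner: "(\<integral>\<^sup>+ y. ennreal ((norm (x + y))\<^sup>2) * ?t y \<partial>D)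
      \<le> ennreal ((norm x)\<^sup>2) * ennreal (2 * (c * b powr - r)) + ennreal (2 * (c * b powr (2 - r)))" for x :: 'h
  proof -
    have "(\<integral>\<^sup>+ y. ennreal ((norm (x + y))\<^sup>2) * ?t y \<partial>D)
      \<le> (\<integral>\<^sup>+ y. ennreal (2 * (norm x)\<^sup>2) * ?t y + 2 * (ennreal ((norm y)\<^sup>2) * ?t y) \<partial>D)"
    proof (intro nn_integral_mono)
      fix y
      have "ennreal ((norm (x + y))\<^sup>2) \<le> ennreal (2 * (norm x)\<^sup>2 + 2 * (norm y)\<^sup>2)"
        by (intro ennreal_leI norm_add_sq_le)
      also have "\<dots> = ennreal (2 * (norm x)\<^sup>2) + 2 * ennreal ((norm y)\<^sup>2)"
        by (simp add: ennreal_mult)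
      finally show "ennreal ((norm (x + y))\<^sup>2) * ?t y
          \<le> ennreal (2 * (norm x)\<^sup>2) * ?t y + 2 * (ennreal ((norm y)\<^sup>2) * ?t y)"
        by (auto split: split_indicator)
    qed
    also have "\<dots> = ennreal (2 * (norm x)\<^sup>2) * emeasure D {y. b < norm y}
        + 2 * (\<integral>\<^sup>+ y. ennreal ((norm y)\<^sup>2) * ?t y \<partial>D)"
      by (subst nn_integral_add) (auto simp: nn_integral_cmult nn_integral_cmult_indicator)
    also have "\<dots> \<le> ennreal (2 * (norm x)\<^sup>2) * ennreal (c * b powr - r) + 2 * ennreal (c * b powr (2 - r))"
      using emeasure_tail_le[OF b] nn_integral_sq_tail_le[OF b] by (intro add_mono mult_left_mono) auto
    also have "\<dots> = ennreal ((norm x)\<^sup>2) * ennreal (2 * (c * b powr - r)) + ennreal (2 * (c * b powr (2 - r)))"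
      using c_nonneg by (simp add: ennreal_mult mult_ac)
    finally show ?thesis .
  qed
  have "(\<integral>\<^sup>+ \<xi>. ennreal ((norm (\<Sum>j\<in>I. \<xi> j))\<^sup>2) * ?t (\<xi> i) \<partial>PiM I (\<lambda>_. D))
    = (\<integral>\<^sup>+ \<xi>. (\<integral>\<^sup>+ y. ennreal ((norm ((\<Sum>j\<in>J. \<xi> j) + y))\<^sup>2) * ?t y \<partial>D) \<partial>PiM J (\<lambda>_. D))"
    unfolding IJ by (subst P.product_nn_integral_insert[OF J]) (simp_all only: upd fun_upd_same, measurable)
  also have "\<dots> \<le> (\<integral>\<^sup>+ \<xi>. ennreal ((norm (\<Sum>j\<in>J. \<xi> j))\<^sup>2) * ennreal (2 * (c * b powr - r))
      + ennreal (2 * (c * b powr (2 - r))) \<partial>PiM J (\<lambda>_. D))"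
    by (intro nn_integral_mono inner)
  also have "\<dots> = (\<integral>\<^sup>+ \<xi>. ennreal ((norm (\<Sum>j\<in>J. \<xi> j))\<^sup>2) \<partial>PiM J (\<lambda>_. D)) * ennreal (2 * (c * b powr - r))
      + ennreal (2 * (c * b powr (2 - r)))"
    using P.emeasure_space_1 by (subst nn_integral_add) (auto simp: nn_integral_multc)
  also have "\<dots> \<le> ennreal (real (card I)) * ennreal (2 * (c * b powr - r)) + ennreal (2 * (c * b powr (2 - r)))"
  proof (intro add_mono mult_right_mono order_refl)
    have "(\<integral>\<^sup>+ \<xi>. ennreal ((norm (\<Sum>j\<in>J. \<xi> j))\<^sup>2) \<partial>PiM J (\<lambda>_. D)) \<le> ennreal (real (card J))"
      by (rule nn_integral_norm_sum_sq[OF J(1)])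
    also have "\<dots> \<le> ennreal (real (card I))" using J by (intro ennreal_leI) (simp add: IJ)
    finally show "(\<integral>\<^sup>+ \<xi>. ennreal ((norm (\<Sum>j\<in>J. \<xi> j))\<^sup>2) \<partial>PiM J (\<lambda>_. D)) \<le> ennreal (real (card I))" .
  qed simp
  also have "\<dots> = ennreal (2 * real (card I) * c * b powr - r + 2 * c * b powr (2 - r))"
    using c_nonneg by (simp add: ennreal_mult[symmetric] ennreal_plus[symmetric] algebra_simps del: ennreal_plus)
  finally show ?thesis .
qed

section \<open>The excess for a free truncation level and radius\<close>

text \<open>The space is split into three events: some summand exceeds \<open>b\<close>; all are
  bounded and the walk stays in the ball; all are bounded and the walk leaves it. On the last two
  the excess is dominated by a multiple of the exponential whose integral is already
  bounded.\<close>

lemma nn_integral_excess_le: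
  assumes n: "n > 0" and R: "R \<ge> 0" and b: "b > 0"
    and Rb: "R * b \<le> 4 * w * real n" and bb: "b\<^sup>2 \<le> 8 * w * real n"
    and \<theta>: "\<theta> = 1 / (32 * w * real n)"
  shows "(\<integral>\<^sup>+ \<xi>. ennreal (max ((norm (\<Sum>i=1..n. \<xi> i))\<^sup>2 - 12 * real n) 0) \<partial>PiM {1..n} (\<lambda>_. D))
    \<le> ennreal (real n * (2 * real n * c * b powr - r + 2 * c * b powr (2 - r))
        + ((real n * b)\<^sup>2 * exp (4 * \<theta> * real n - \<theta> * R\<^sup>2) + 32 * w * real n * exp (- 8 * \<theta> * real n)))"
proof -
  interpret P: product_prob_space "\<lambda>_::nat. D" "{1..n}" ..
  let ?P = "PiM {1..n} (\<lambda>_. D)"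
  have \<theta>_pos: "\<theta> > 0" using w_pos n by (simp add: \<theta>)
  \<comment> \<open>The first term is the prefactor on the exit event, the second the prefactor
    inside the ball; their sum serves both cases.\<close>
  define K where "K = (real n * b)\<^sup>2 * exp (- \<theta> * R\<^sup>2) + 1 / \<theta> * exp (- 12 * \<theta> * real n)"
  have K0: "K \<ge> 0" using \<theta>_pos by (auto simp: K_def)
  let ?S = "\<lambda>\<xi>::nat \<Rightarrow> 'h. \<Sum>i=1..n. \<xi> i"
  let ?T = "\<lambda>\<xi>::nat \<Rightarrow> 'h. stopped_sum R \<xi> n"
  let ?B = "{\<xi>::nat \<Rightarrow> 'h. \<forall>i\<in>{1..n}. norm (\<xi> i) \<le> b}"
  let ?L = "\<lambda>\<xi>. \<Sum>i=1..n. ennreal ((norm (?S \<xi>))\<^sup>2) * indicator {y. b < norm y} (\<xi> i)"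
  let ?E = "\<lambda>\<xi>. ennreal (exp (\<theta> * (norm (?T \<xi>))\<^sup>2)) * indicator ?B \<xi>"
  have [measurable]: "(\<lambda>\<xi>. ?T \<xi>) \<in> borel_measurable ?P"
    by (rule measurable_stopped_sum) simp
  have [measurable]: "(indicator ?B :: _ \<Rightarrow> ennreal) \<in> borel_measurable ?P"
    by (rule bounded_event_measurable) simp_all
  have pointwise: "ennreal (max ((norm (?S \<xi>))\<^sup>2 - 12 * real n) 0) \<le> ?L \<xi> + ennreal K * ?E \<xi>" for \<xi>
  proof (cases "\<xi> \<in> ?B")
    \<comment> \<open>Summing over all \<open>i\<close> avoids selecting which summand is
      large.\<close>
    case False
    then obtain i where i: "i \<in> {1..n}" "b < norm (\<xi> i)" by (auto simp: not_le)
    have "ennreal (max ((norm (?S \<xi>))\<^sup>2 - 12 * real n) 0)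
        \<le> ennreal ((norm (?S \<xi>))\<^sup>2) * indicator {y. b < norm y} (\<xi> i)"
      using i by (auto intro!: ennreal_leI)
    also have "\<dots> \<le> ?L \<xi>" using i by (intro member_le_sum) auto
    finally show ?thesis by (rule order_trans) simp
  next
    case True
    have "max ((norm (?S \<xi>))\<^sup>2 - 12 * real n) 0 \<le> K * exp (\<theta> * (norm (?T \<xi>))\<^sup>2)"
    proof (cases "norm (?T \<xi>) \<le> R")
      case T: True
      then have ST: "?S \<xi> = ?T \<xi>" using stopped_sum_eq_sum[of R \<xi> n] by simp
      \<comment> \<open>The excess is turned into an exponential by \<open>t <= exp t\<close>, which
        costs the factor \<open>1 / \<theta>\<close>.\<close>
      have "\<theta> * ((norm (?T \<xi>))\<^sup>2 - 12 * real n) \<le> exp (\<theta> * ((norm (?T \<xi>))\<^sup>2 - 12 * real n))"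
        using exp_ge_add_one_self[of "\<theta> * ((norm (?T \<xi>))\<^sup>2 - 12 * real n)"] by linarith
      then have "(norm (?T \<xi>))\<^sup>2 - 12 * real n \<le> 1 / \<theta> * exp (\<theta> * ((norm (?T \<xi>))\<^sup>2 - 12 * real n))"
        using \<theta>_pos by (simp add: field_simps)
      also have "\<dots> = 1 / \<theta> * exp (- 12 * \<theta> * real n) * exp (\<theta> * (norm (?T \<xi>))\<^sup>2)"
        by (simp add: exp_add[symmetric] algebra_simps)
      also have "\<dots> \<le> K * exp (\<theta> * (norm (?T \<xi>))\<^sup>2)"
        by (intro mult_right_mono) (auto simp: K_def)
      finally show ?thesis unfolding ST using K0 by simp
    next
      case False
      have "norm (?S \<xi>) \<le> (\<Sum>i=1..n. norm (\<xi> i))" by (rule norm_sum)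
      also have "\<dots> \<le> (\<Sum>i=1..n. b)" using True by (intro sum_mono) auto
      finally have "norm (?S \<xi>) \<le> real n * b" by simp
      then have "(norm (?S \<xi>))\<^sup>2 \<le> (real n * b)\<^sup>2" by (intro power_mono) auto
      also have "\<dots> \<le> (real n * b)\<^sup>2 * exp (\<theta> * ((norm (?T \<xi>))\<^sup>2 - R\<^sup>2))"
      proof -
        have "R\<^sup>2 \<le> (norm (?T \<xi>))\<^sup>2" using False R by (intro power_mono) auto
        then have "1 \<le> exp (\<theta> * ((norm (?T \<xi>))\<^sup>2 - R\<^sup>2))" using \<theta>_pos by simp
        then show ?thesis using mult_left_mono[of 1 _ "(real n * b)\<^sup>2"] by simp
      qed
      also have "\<dots> = (real n * b)\<^sup>2 * exp (- \<theta> * R\<^sup>2) * exp (\<theta> * (norm (?T \<xi>))\<^sup>2)"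
        by (simp add: exp_add[symmetric] algebra_simps)
      also have "\<dots> \<le> K * exp (\<theta> * (norm (?T \<xi>))\<^sup>2)"
        using \<theta>_pos by (intro mult_right_mono) (auto simp: K_def)
      finally have *: "(norm (?S \<xi>))\<^sup>2 \<le> K * exp (\<theta> * (norm (?T \<xi>))\<^sup>2)" .
      show ?thesis using * K0 by (intro max.boundedI) auto
    qed
    then have "ennreal (max ((norm (?S \<xi>))\<^sup>2 - 12 * real n) 0) \<le> ennreal K * ?E \<xi>"
      using True K0 by (simp add: ennreal_mult[symmetric] ennreal_leI)
    then show ?thesis by (rule order_trans) simp
  qed
  \<comment> \<open>At \<open>k = n\<close> the coefficient \<open>\<theta> * (2 - k / n)\<close> is
    just \<open>\<theta>\<close>.\<close>
  have E_le: "(\<integral>\<^sup>+ \<xi>. ?E \<xi> \<partial>?P) \<le> ennreal (exp (4 * \<theta> * real n))"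
    using nn_integral_exp_stopped_sum[OF n R Rb bb \<theta> order_refl] n by simp
  have "(\<integral>\<^sup>+ \<xi>. ennreal (max ((norm (?S \<xi>))\<^sup>2 - 12 * real n) 0) \<partial>?P)
      \<le> (\<integral>\<^sup>+ \<xi>. ?L \<xi> + ennreal K * ?E \<xi> \<partial>?P)"
    by (intro nn_integral_mono pointwise)
  also have "\<dots> = (\<Sum>i=1..n. \<integral>\<^sup>+ \<xi>. ennreal ((norm (?S \<xi>))\<^sup>2) * indicator {y. b < norm y} (\<xi> i) \<partial>?P)
      + ennreal K * (\<integral>\<^sup>+ \<xi>. ?E \<xi> \<partial>?P)"
    by (subst nn_integral_add, measurable, subst nn_integral_sum, measurable, subst nn_integral_cmult, measurable)
  also have "\<dots> \<le> (\<Sum>i=1..n. ennreal (2 * real n * c * b powr - r + 2 * c * b powr (2 - r)))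
      + ennreal K * ennreal (exp (4 * \<theta> * real n))"
    using nn_integral_norm_sum_sq_large[of "{1..n}" _ b] b
    by (intro add_mono sum_mono mult_left_mono E_le) auto
  also have "\<dots> = ennreal (real n * (2 * real n * c * b powr - r + 2 * c * b powr (2 - r))
      + K * exp (4 * \<theta> * real n))"
    using K0 c_nonneg by (simp add: ennreal_mult ennreal_of_nat_eq_real_of_nat)
  \<comment> \<open>The threshold 12 against the growth rate 4 leaves the exponent
    \<open>- 8 * \<theta> * n\<close>, which equals \<open>- 1 / (4 * w)\<close> for the given
    \<open>\<theta>\<close>.\<close>
  also have "K * exp (4 * \<theta> * real n)
      = (real n * b)\<^sup>2 * exp (4 * \<theta> * real n - \<theta> * R\<^sup>2) + 1 / \<theta> * exp (- 8 * \<theta> * real n)"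
    by (simp add: K_def distrib_right mult.assoc exp_add[symmetric] algebra_simps)
  also have "1 / \<theta> = 32 * w * real n" by (simp add: \<theta>)
  finally show ?thesis .
qed

end

section \<open>Choice of the truncation level and the radius\<close>

text \<open>This is the factor of \<open>L N\<close> in the claimed bound.\<close>

definition excess_rate :: "real \<Rightarrow> nat \<Rightarrow> real" where
  "excess_rate r n = ln (real n) powr (r - 2) / real n powr ((r - 2) / 2)"

lemma ln_nat_ge_half: "n \<ge> 2 \<Longrightarrow> ln (real n) \<ge> 1 / 2"
proof -
  assume n: "n \<ge> 2"
  have "exp (1 / 2 :: real) \<le> 1 + 1 / 2 + (1 / 2)\<^sup>2" by (rule exp_le_quadratic) simp
  also have "\<dots> \<le> real n" using n by (simp add: power2_eq_square)
  finally show ?thesis using n by (subst ln_ge_iff) auto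
qed

lemma ln_nat_sq_le: "n \<ge> 2 \<Longrightarrow> (ln (real n))\<^sup>2 \<le> 4 * real n"
proof -
  assume n: "n \<ge> 2"
  have "ln (real n) = 2 * ln (sqrt (real n))" using n by (simp add: ln_sqrt)
  also have "\<dots> \<le> 2 * sqrt (real n)" using n ln_le_minus_one[of "sqrt (real n)"] by simp
  finally have "(ln (real n))\<^sup>2 \<le> (2 * sqrt (real n))\<^sup>2"
    using ln_nat_ge_half[OF n] by (intro power_mono) auto
  then show ?thesis by (simp add: power_mult_distrib)
qed

text \<open>From \<open>n = 2\<close> on, \<open>2 * ln n >= 1\<close>, so inserting the logarithmic
  factor costs at most \<open>2 powr (r - 2)\<close>.\<close>

lemma powr_le_excess_rate:
  assumes n: "n \<ge> 2" and r: "r > 2"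
  shows "real n powr (- ((r - 2) / 2)) \<le> 2 powr (r - 2) * excess_rate r n"
proof -
  have "1 \<le> (2 * ln (real n)) powr (r - 2)"
    using ln_nat_ge_half[OF n] r by (intro ge_one_powr_ge_zero) auto
  then have "1 \<le> 2 powr (r - 2) * ln (real n) powr (r - 2)"
    using ln_nat_ge_half[OF n] by (simp add: powr_mult)
  then show ?thesis
    using n by (simp add: excess_rate_def powr_minus field_simps)
qed

text \<open>With \<open>A = 16 + 4 * r\<close>, the first two terms stem from the tail probability
  and the truncated second moment at level \<open>b\<close>. Of the coefficient 33, one unit pays
  for the exit from the ball and 32 for enlarging \<open>w\<close>.\<close>

definition excess_const :: "real \<Rightarrow> real \<Rightarrow> real" where
  "excess_const r c = 8 * c * (16 + 4 * r) powr r + 2 * c * (16 + 4 * r) powr (r - 2) + 33 * 2 powr (r - 2)"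

text \<open>For every \<open>t\<close>, \<open>b powr - t\<close> equals
  \<open>A powr t * ln n powr t / n powr (t / 2)\<close>. For \<open>t = r - 2\<close> this is the
  rate itself; for \<open>t = r\<close> there is an extra factor \<open>(ln n)^2 / n\<close>, which
  is at most 4.\<close>

lemma truncation_powr_bounds:
  fixes A r :: real
  assumes n: "n \<ge> 2" and A: "A > 0" and b: "b = sqrt (real n) / (A * ln (real n))"
  shows "b powr - r \<le> 4 * A powr r * excess_rate r n"
    and "b powr (2 - r) = A powr (r - 2) * excess_rate r n"
proof -
  have l: "ln (real n) > 0" using ln_nat_ge_half[OF n] by simp
  have np: "real n > 0" using n by simp
  have b_powr: "b powr - t = A powr t * (ln (real n) powr t / real n powr (t / 2))" for t
  proof -
    have "b powr - t = (A * ln (real n)) powr t / sqrt (real n) powr t"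
      using A l np by (simp add: b powr_minus powr_divide field_simps)
    also have "sqrt (real n) powr t = real n powr (t / 2)"
      using np by (simp add: powr_half_sqrt[symmetric] powr_powr)
    finally show ?thesis using A l by (simp add: powr_mult)
  qed
  show "b powr (2 - r) = A powr (r - 2) * excess_rate r n"
    using b_powr[of "r - 2"] by (simp add: excess_rate_def)
  have "ln (real n) powr r = ln (real n) powr (r - 2) * (ln (real n))\<^sup>2"
    using l by (simp add: powr_diff)
  moreover have "real n powr (r / 2) = real n powr ((r - 2) / 2) * real n"
    using np by (simp add: diff_divide_distrib powr_diff)
  ultimately have "b powr - r = A powr r * (excess_rate r n * ((ln (real n))\<^sup>2 / real n))"
    unfolding b_powr by (simp add: excess_rate_def)
  also have "\<dots> \<le> A powr r * (excess_rate r n * 4)"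
    using ln_nat_sq_le[OF n] np by (intro mult_left_mono) (auto simp: divide_le_eq excess_rate_def)
  finally show "b powr - r \<le> 4 * A powr r * excess_rate r n" by simp
qed

context normalized_law
begin

text \<open>The regime in which the weak variance is not too small, so that \<open>b\<close> and
  \<open>R\<close> satisfy the smallness conditions. The portion \<open>32 * 2 powr (r - 2)\<close>
  of the constant is held back for the removal of the lower bound on \<open>w\<close>.\<close>

lemma excess_bound_spread:
  assumes n: "n \<ge> 2" and w_ge: "w \<ge> 1 / ((16 + 4 * r) * ln (real n))"
  shows "(\<integral>\<^sup>+ \<xi>. ennreal (max ((norm (\<Sum>i=1..n. \<xi> i))\<^sup>2 - 12 * real n) 0) \<partial>PiM {1..n} (\<lambda>_. D))
    \<le> ennreal ((real n)\<^sup>2 * ((excess_const r c - 32 * 2 powr (r - 2)) * excess_rate r n)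
        + 32 * w * real n * exp (- 1 / (4 * w)))"
proof -
  \<comment> \<open>\<open>A\<close> is large enough that \<open>n * exp (- A ln n / 8)\<close>, which bounds the exit probability times \<open>b\<^sup>2\<close>,
    is at most \<open>n powr (- (r - 2) / 2)\<close>.\<close>
  define A where "A = 16 + 4 * r"
  define l where "l = ln (real n)"
  define b where "b = sqrt (real n) / (A * l)"
  \<comment> \<open>The radius makes \<open>\<theta> * R^2\<close> equal to
    \<open>A * l / 4\<close>, twice the upper bound \<open>A * l / 8\<close> for the growth exponent
    \<open>4 * \<theta> * n\<close>.\<close>
  define R where "R = sqrt (8 * A * w * real n * l)"
  define \<theta> where "\<theta> = 1 / (32 * w * real n)"
  have np: "real n > 0" "real n \<ge> 1" using n by auto
  have l: "l > 0" "l \<ge> 1 / 2" using ln_nat_ge_half[OF n] by (auto simp: l_def)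
  have A: "A \<ge> 24" using r_gt by (simp add: A_def)
  have "24 * (1 / 2) \<le> A * l" using A l by (intro mult_mono) auto
  then have Al: "A * l \<ge> 1" "A * l > 0" by auto
  \<comment> \<open>The lower bound on \<open>w\<close> enters in this form: once for each smallness
    condition, and once to bound \<open>1 / (8 * w)\<close>.\<close>
  have wAl: "1 \<le> w * (A * l)"
  proof -
    have "1 / (A * l) \<le> w" using w_ge unfolding A_def l_def .
    then show ?thesis using Al by (simp add: divide_le_eq)
  qed
  have b_pos: "b > 0" using np Al by (simp add: b_def)
  have bsq: "b\<^sup>2 = real n / (A * l)\<^sup>2" using np by (simp add: b_def power_divide)
  have Rsq: "R\<^sup>2 = 8 * A * w * real n * l" using np A l w_pos by (simp add: R_def)
  have R0: "R \<ge> 0" using np A l w_pos by (simp add: R_def)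
  \<comment> \<open>Squaring removes the square roots. The product is
    \<open>8 * w * n^2 / (A * l)\<close>, and \<open>1 / (A * l) <= w\<close> makes it at most
    \<open>8 * w^2 * n^2\<close>, half of what is allowed.\<close>
  have "(R * b)\<^sup>2 = (8 * A * w * real n * l) * (real n / (A * l)\<^sup>2)"
    by (simp only: power_mult_distrib[of R b] bsq Rsq)
  also have "\<dots> = 8 * w * (real n)\<^sup>2 / (A * l)"
    using A l by (simp add: power2_eq_square field_simps)
  also have "\<dots> \<le> 8 * w * (real n)\<^sup>2 * w"
    using wAl Al w_pos np by (simp add: divide_le_eq mult_ac)
  also have "\<dots> \<le> (4 * w * real n)\<^sup>2"
    using w_pos by (simp add: power2_eq_square)
  finally have Rb: "R * b \<le> 4 * w * real n"
    using w_pos np by (intro power2_le_imp_le[of "R * b"]) auto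
  have "1 / (A * l)\<^sup>2 \<le> 1 / (A * l)"
    using Al by (simp add: field_simps power2_eq_square)
  also have "\<dots> \<le> w" using wAl Al by (simp add: field_simps)
  finally have "real n * (1 / (A * l)\<^sup>2) \<le> real n * (8 * w)"
    using w_pos np by (intro mult_left_mono) auto
  then have bb: "b\<^sup>2 \<le> 8 * w * real n" by (simp add: bsq mult.commute)
  have e1: "- 8 * \<theta> * real n = - 1 / (4 * w)" using np w_pos by (simp add: \<theta>_def)
  have "4 * \<theta> * real n = 1 / (8 * w)" using np w_pos by (simp add: \<theta>_def)
  also have "\<dots> \<le> A * l / 8" using wAl w_pos by (simp add: field_simps)
  finally have "4 * \<theta> * real n \<le> A * l / 8" .
  moreover have "\<theta> * R\<^sup>2 = A * l / 4" using np w_pos by (simp add: \<theta>_def Rsq)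
  ultimately have "4 * \<theta> * real n - \<theta> * R\<^sup>2 \<le> - (A / 8) * l" by simp
  then have "exp (4 * \<theta> * real n - \<theta> * R\<^sup>2) \<le> real n powr (- (A / 8))"
    using np by (simp add: powr_def l_def)
  moreover have "b\<^sup>2 \<le> real n"
    unfolding bsq using Al np by (simp add: divide_le_eq)
  ultimately have "b\<^sup>2 * exp (4 * \<theta> * real n - \<theta> * R\<^sup>2) \<le> real n * real n powr (- (A / 8))"
    by (intro mult_mono) auto
  also have "\<dots> = real n powr (1 - A / 8)" using np by (simp add: powr_mult_base)
  also have "\<dots> \<le> real n powr (- ((r - 2) / 2))"
    using np by (intro powr_mono) (auto simp: A_def field_simps)
  also have "\<dots> \<le> 2 powr (r - 2) * excess_rate r n"
    by (rule powr_le_excess_rate[OF n r_gt])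
  finally have t3: "b\<^sup>2 * exp (4 * \<theta> * real n - \<theta> * R\<^sup>2) \<le> 2 powr (r - 2) * excess_rate r n" .
  have rate0: "excess_rate r n \<ge> 0" by (simp add: excess_rate_def)
  have t12: "b powr - r \<le> 4 * A powr r * excess_rate r n" "b powr (2 - r) = A powr (r - 2) * excess_rate r n"
    using truncation_powr_bounds[OF n, of A b r] A by (auto simp: b_def l_def)
  have "real n * (2 * real n * c * b powr - r + 2 * c * b powr (2 - r))
        + (real n * b)\<^sup>2 * exp (4 * \<theta> * real n - \<theta> * R\<^sup>2)
      = (real n)\<^sup>2 * (2 * c * b powr - r) + real n * (2 * c * b powr (2 - r))
        + (real n)\<^sup>2 * (b\<^sup>2 * exp (4 * \<theta> * real n - \<theta> * R\<^sup>2))"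
    by (simp add: algebra_simps power2_eq_square)
  also have "\<dots> \<le> (real n)\<^sup>2 * (2 * c * (4 * A powr r * excess_rate r n))
        + (real n)\<^sup>2 * (2 * c * (A powr (r - 2) * excess_rate r n))
        + (real n)\<^sup>2 * (2 powr (r - 2) * excess_rate r n)"
  proof (intro add_mono mult_left_mono t3 t12)
    show "real n * (2 * c * b powr (2 - r)) \<le> (real n)\<^sup>2 * (2 * c * (A powr (r - 2) * excess_rate r n))"
      unfolding t12(2) using np c_nonneg rate0
      by (intro mult_right_mono) (auto simp: power2_eq_square)
  qed (use c_nonneg in auto)
  also have "\<dots> = (real n)\<^sup>2 * ((excess_const r c - 32 * 2 powr (r - 2)) * excess_rate r n)"
    by (simp add: excess_const_def A_def algebra_simps)
  finally have fin: "real n * (2 * real n * c * b powr - r + 2 * c * b powr (2 - r))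
        + (real n * b)\<^sup>2 * exp (4 * \<theta> * real n - \<theta> * R\<^sup>2)
      \<le> (real n)\<^sup>2 * ((excess_const r c - 32 * 2 powr (r - 2)) * excess_rate r n)" .
  have "(\<integral>\<^sup>+ \<xi>. ennreal (max ((norm (\<Sum>i=1..n. \<xi> i))\<^sup>2 - 12 * real n) 0) \<partial>PiM {1..n} (\<lambda>_. D))
    \<le> ennreal (real n * (2 * real n * c * b powr - r + 2 * c * b powr (2 - r))
        + ((real n * b)\<^sup>2 * exp (4 * \<theta> * real n - \<theta> * R\<^sup>2) + 32 * w * real n * exp (- 8 * \<theta> * real n)))"
    using n by (intro nn_integral_excess_le R0 b_pos Rb bb \<theta>_def) auto
  also have "\<dots> \<le> ennreal ((real n)\<^sup>2 * ((excess_const r c - 32 * 2 powr (r - 2)) * excess_rate r n)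
        + 32 * w * real n * exp (- 1 / (4 * w)))"
    unfolding e1 using fin by (intro ennreal_leI) simp
  finally show ?thesis .
qed

text \<open>A small \<open>w\<close> is raised to the smallest value \<open>w0\<close> allowed in
  the previous lemma. The residual term belonging to \<open>w0\<close> is a negative power of
  \<open>n\<close> and is absorbed by the rate.\<close>

lemma excess_bound:
  assumes n: "n \<ge> 2"
  shows "(\<integral>\<^sup>+ \<xi>. ennreal (max ((norm (\<Sum>i=1..n. \<xi> i))\<^sup>2 - 12 * real n) 0) \<partial>PiM {1..n} (\<lambda>_. D))
    \<le> ennreal ((real n)\<^sup>2 * (excess_const r c * excess_rate r n) + 32 * w * real n * exp (- 1 / (4 * w)))"
proof -
  define A where "A = 16 + 4 * r"
  define w0 where "w0 = 1 / (A * ln (real n))"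
  define w' where "w' = max w w0"
  have np: "real n > 0" "real n \<ge> 1" using n by auto
  have l: "ln (real n) > 0" "ln (real n) \<ge> 1 / 2" using ln_nat_ge_half[OF n] by auto
  have A: "A \<ge> 24" using r_gt by (simp add: A_def)
  have "24 * (1 / 2) \<le> A * ln (real n)" using A l by (intro mult_mono) auto
  then have Al: "A * ln (real n) \<ge> 1" by simp
  then have w0: "0 < w0" "w0 \<le> 1" by (auto simp: w0_def)
  interpret W: normalized_law D w' r c
  proof
    show "sets D = sets borel" "2 < r" "integrable D (\<lambda>y. (norm y)\<^sup>2)" "(\<integral>y. y \<partial>D) = 0"
      "(\<integral>y. (norm y)\<^sup>2 \<partial>D) \<le> 1" "0 \<le> c" "(\<integral>\<^sup>+ y. ennreal (norm y powr r) \<partial>D) \<le> ennreal c"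
      using r_gt integrable_sq mean_zero sq_le c_nonneg moment_le by auto
    show "0 < w'" using w_pos by (simp add: w'_def)
    show "(\<integral>y. (x \<bullet> y)\<^sup>2 \<partial>D) \<le> w' * (norm x)\<^sup>2" for x
      using weak_le[of x] by (rule order_trans) (intro mult_right_mono, auto simp: w'_def)
  qed
  have rate0: "excess_rate r n \<ge> 0" by (simp add: excess_rate_def)
  \<comment> \<open>\<open>w'\<close> is one of \<open>w\<close> and \<open>w0\<close>, and both
    summands on the right are nonnegative.\<close>
  have "w' * exp (- 1 / (4 * w')) \<le> w * exp (- 1 / (4 * w)) + w0 * exp (- 1 / (4 * w0))"
    using w_pos w0 by (auto simp: w'_def max_def)
  \<comment> \<open>Here \<open>1 / (4 * w0) = A * ln n / 4\<close>, and \<open>w0 <= 1\<close>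
    removes the prefactor.\<close>
  also have "w0 * exp (- 1 / (4 * w0)) \<le> real n powr (- (A / 4))"
    using w0 np mult_right_mono[OF w0(2), of "exp (- 1 / (4 * w0))"]
    by (simp add: w0_def powr_def mult_ac)
  finally have "32 * real n * (w' * exp (- 1 / (4 * w')))
      \<le> 32 * real n * (w * exp (- 1 / (4 * w)) + real n powr (- (A / 4)))"
    using np by (intro mult_left_mono) auto
  also have "\<dots> = 32 * (real n * real n powr (- (A / 4))) + 32 * w * real n * exp (- 1 / (4 * w))"
    by (simp add: algebra_simps)
  also have "\<dots> \<le> (real n)\<^sup>2 * (32 * 2 powr (r - 2) * excess_rate r n) + 32 * w * real n * exp (- 1 / (4 * w))"
  proof -
    have "real n powr (- (A / 4)) \<le> real n powr (- ((r - 2) / 2))"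
      using np r_gt by (intro powr_mono) (auto simp: A_def field_simps)
    also have "\<dots> \<le> 2 powr (r - 2) * excess_rate r n"
      by (rule powr_le_excess_rate[OF n r_gt])
    finally have "real n * real n powr (- (A / 4)) \<le> (real n)\<^sup>2 * (2 powr (r - 2) * excess_rate r n)"
      using np by (intro mult_mono) (auto simp: power2_eq_square)
    then show ?thesis by simp
  qed
  finally have *: "32 * w' * real n * exp (- 1 / (4 * w'))
      \<le> (real n)\<^sup>2 * (32 * 2 powr (r - 2) * excess_rate r n) + 32 * w * real n * exp (- 1 / (4 * w))"
    by (simp add: mult_ac)
  have "(\<integral>\<^sup>+ \<xi>. ennreal (max ((norm (\<Sum>i=1..n. \<xi> i))\<^sup>2 - 12 * real n) 0) \<partial>PiM {1..n} (\<lambda>_. D))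
    \<le> ennreal ((real n)\<^sup>2 * ((excess_const r c - 32 * 2 powr (r - 2)) * excess_rate r n)
        + 32 * w' * real n * exp (- 1 / (4 * w')))"
    by (rule W.excess_bound_spread[OF n]) (simp add: w'_def w0_def A_def)
  also have "\<dots> \<le> ennreal ((real n)\<^sup>2 * ((excess_const r c - 32 * 2 powr (r - 2)) * excess_rate r n)
        + ((real n)\<^sup>2 * (32 * 2 powr (r - 2) * excess_rate r n) + 32 * w * real n * exp (- 1 / (4 * w))))"
    using * by (intro ennreal_leI add_left_mono)
  finally show ?thesis by (simp add: algebra_simps)
qed

end

section \<open>From a random element to its standardised law\<close>

text \<open>Fatou's lemma along a sequence in \<open>S0\<close> converging to the normalised
  direction, followed by homogeneity in \<open>x\<close>.\<close>

lemma nn_integral_inner_sq_le_of_dense: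
  fixes Z :: "'a \<Rightarrow> 'h::{real_inner, banach, second_countable_topology}"
  assumes Z [measurable]: "Z \<in> borel_measurable M"
    and dense: "sphere 0 1 \<subseteq> closure S0" and v: "v \<ge> 0"
    and le: "\<And>\<psi>. \<psi> \<in> S0 \<Longrightarrow> (\<integral>\<^sup>+ \<omega>. ennreal ((Z \<omega> \<bullet> \<psi>)\<^sup>2) \<partial>M) \<le> ennreal v"
  shows "(\<integral>\<^sup>+ \<omega>. ennreal ((Z \<omega> \<bullet> x)\<^sup>2) \<partial>M) \<le> ennreal (v * (norm x)\<^sup>2)"
proof (cases "x = 0")
  case False
  define u where "u = x /\<^sub>R norm x"
  have "u \<in> closure S0" using False dense by (auto simp: u_def)
  then obtain \<psi> where \<psi>: "\<And>k. \<psi> k \<in> S0" "\<psi> \<longlonglongrightarrow> u"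
    unfolding closure_sequential by blast
  have lim: "(\<lambda>k. ennreal ((Z \<omega> \<bullet> \<psi> k)\<^sup>2)) \<longlonglongrightarrow> ennreal ((Z \<omega> \<bullet> u)\<^sup>2)" for \<omega>
    using \<psi>(2) by (intro tendsto_intros)
  have "(\<integral>\<^sup>+ \<omega>. ennreal ((Z \<omega> \<bullet> u)\<^sup>2) \<partial>M) = (\<integral>\<^sup>+ \<omega>. liminf (\<lambda>k. ennreal ((Z \<omega> \<bullet> \<psi> k)\<^sup>2)) \<partial>M)"
    by (intro nn_integral_cong lim_imp_Liminf[symmetric] lim) simp
  also have "\<dots> \<le> liminf (\<lambda>k. \<integral>\<^sup>+ \<omega>. ennreal ((Z \<omega> \<bullet> \<psi> k)\<^sup>2) \<partial>M)"
    by (rule nn_integral_liminf) measurable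
  also have "\<dots> \<le> liminf (\<lambda>k. ennreal v)"
    using \<psi>(1) le by (intro Liminf_mono always_eventually) auto
  also have "\<dots> = ennreal v" by (simp add: Liminf_const)
  finally have u: "(\<integral>\<^sup>+ \<omega>. ennreal ((Z \<omega> \<bullet> u)\<^sup>2) \<partial>M) \<le> ennreal v" .
  have "x = norm x *\<^sub>R u" using False by (simp add: u_def)
  then have "(Z \<omega> \<bullet> x)\<^sup>2 = (norm x)\<^sup>2 * (Z \<omega> \<bullet> u)\<^sup>2" for \<omega>
    by (metis inner_scaleR_right power_mult_distrib)
  then have "(\<integral>\<^sup>+ \<omega>. ennreal ((Z \<omega> \<bullet> x)\<^sup>2) \<partial>M) = (\<integral>\<^sup>+ \<omega>. ennreal ((norm x)\<^sup>2) * ennreal ((Z \<omega> \<bullet> u)\<^sup>2) \<partial>M)"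
    by (simp add: ennreal_mult)
  also have "\<dots> = ennreal ((norm x)\<^sup>2) * (\<integral>\<^sup>+ \<omega>. ennreal ((Z \<omega> \<bullet> u)\<^sup>2) \<partial>M)"
    by (rule nn_integral_cmult) measurable
  also have "\<dots> \<le> ennreal ((norm x)\<^sup>2) * ennreal v" using u by (rule mult_left_mono) simp
  finally show ?thesis using v by (simp add: ennreal_mult mult.commute)
qed simp

locale hilbert_random_element = prob_space M
  for M :: "'a measure" and Z :: "'a \<Rightarrow> 'h::{real_inner, banach, second_countable_topology}" +
  fixes s v r c :: real
  assumes Z [measurable]: "Z \<in> borel_measurable M"
    and s_pos: "s > 0" and v_pos: "v > 0" and r_gt: "r > 2" and c_nonneg: "c \<ge> 0"
    and second_moment: "(\<integral>\<^sup>+ \<omega>. ennreal ((norm (Z \<omega>))\<^sup>2) \<partial>M) \<le> ennreal (s\<^sup>2)"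
    and weak_variance: "\<And>x. (\<integral>\<^sup>+ \<omega>. ennreal ((Z \<omega> \<bullet> x)\<^sup>2) \<partial>M) \<le> ennreal (v * (norm x)\<^sup>2)"
    and moment: "(\<integral>\<^sup>+ \<omega>. ennreal (norm (Z \<omega>) powr r) \<partial>M) \<le> ennreal (c * s powr r)"
begin

definition standardize :: "'h \<Rightarrow> 'h" where
  "standardize z = (z - expectation Z) /\<^sub>R s"

lemma measurable_standardize [measurable]: "standardize \<in> borel_measurable borel"
  unfolding standardize_def by measurable

lemma integrable_norm_sq: "integrable M (\<lambda>\<omega>. (norm (Z \<omega>))\<^sup>2)"
  using second_moment by (intro integrableI_bounded) (auto intro: le_less_trans)

lemma norm_sq_le: "expectation (\<lambda>\<omega>. (norm (Z \<omega>))\<^sup>2) \<le> s\<^sup>2"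
  using second_moment by (subst (asm) nn_integral_eq_integral[OF integrable_norm_sq]) auto

lemma integrable_Z: "integrable M Z"
  by (rule integrable_of_integrable_norm_sq[OF Z integrable_norm_sq])

text \<open>The variance \<open>E |Z - E Z|^2 = E |Z|^2 - |E Z|^2\<close> is nonnegative.\<close>

lemma norm_expectation_le: "norm (expectation Z) \<le> s"
proof -
  let ?m = "expectation Z"
  have eq: "(norm (Z \<omega> - ?m))\<^sup>2 = (norm (Z \<omega>))\<^sup>2 - 2 * (?m \<bullet> Z \<omega>) + (norm ?m)\<^sup>2" for \<omega>
    by (simp add: power2_norm_eq_inner inner_diff_left inner_diff_right inner_commute)
  have "0 \<le> expectation (\<lambda>\<omega>. (norm (Z \<omega> - ?m))\<^sup>2)" by simp
  also have "\<dots> = expectation (\<lambda>\<omega>. (norm (Z \<omega>))\<^sup>2) - (norm ?m)\<^sup>2"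
    unfolding eq using integrable_norm_sq integrable_Z by (simp add: prob_space power2_norm_eq_inner)
  also have "\<dots> \<le> s\<^sup>2 - (norm ?m)\<^sup>2" using norm_sq_le by simp
  finally show ?thesis using s_pos by (intro power2_le_imp_le[of "norm ?m"]) auto
qed

text \<open>Centring only decreases second moments, strong and weak, so the bounds for
  \<open>Z\<close> carry over and scaling by \<open>s\<close> turns them into 1 and
  \<open>v / s^2\<close>. In the constant \<open>2 powr r * (c + 1)\<close>, \<open>c\<close>
  accounts for \<open>Z\<close> and 1 for its mean.\<close>

sublocale std: normalized_law "distr M borel (\<lambda>\<omega>. standardize (Z \<omega>))" "v / s\<^sup>2" r "2 powr r * (c + 1)"
proof (intro normalized_law.intro normalized_law_axioms.intro)
  let ?m = "expectation Z"
  let ?D = "distr M borel (\<lambda>\<omega>. standardize (Z \<omega>))"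
  have [measurable]: "(\<lambda>\<omega>. standardize (Z \<omega>)) \<in> borel_measurable M" by measurable
  have norm_std: "(norm (standardize z))\<^sup>2 = ((norm z)\<^sup>2 - 2 * (?m \<bullet> z) + (norm ?m)\<^sup>2) / s\<^sup>2" for z
  proof -
    have "(norm (standardize z))\<^sup>2 = (norm (z - ?m))\<^sup>2 / s\<^sup>2"
      by (simp add: standardize_def power_mult_distrib power_inverse divide_inverse)
    then show ?thesis
      by (simp add: power2_norm_eq_inner inner_diff_left inner_diff_right inner_commute)
  qed
  show "prob_space ?D" by (rule prob_space_distr) measurable
  show "sets ?D = sets borel" by simp
  show "0 < v / s\<^sup>2" using s_pos v_pos by simp
  show "2 < r" by (rule r_gt)
  show "0 \<le> 2 powr r * (c + 1)" using c_nonneg by simp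
  show "integrable ?D (\<lambda>y. (norm y)\<^sup>2)"
    using integrable_norm_sq integrable_Z by (simp add: integrable_distr_eq norm_std)
  show "(\<integral>y. y \<partial>?D) = 0"
    using integrable_Z by (simp add: integral_distr standardize_def prob_space)
  have mm: "?m \<bullet> ?m = (norm ?m)\<^sup>2" by (simp add: power2_norm_eq_inner)
  have "(\<integral>y. (norm y)\<^sup>2 \<partial>?D) = expectation (\<lambda>\<omega>. (norm (standardize (Z \<omega>)))\<^sup>2)"
    by (rule integral_distr) measurable
  also have "\<dots> = (expectation (\<lambda>\<omega>. (norm (Z \<omega>))\<^sup>2) - (norm ?m)\<^sup>2) / s\<^sup>2"
    unfolding norm_std using integrable_norm_sq integrable_Z by (simp add: prob_space mm)
  also have "\<dots> \<le> s\<^sup>2 / s\<^sup>2"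
    using norm_sq_le by (intro divide_right_mono) (auto simp: diff_le_eq add_increasing2)
  finally show "(\<integral>y. (norm y)\<^sup>2 \<partial>?D) \<le> 1" using s_pos by simp
  show "(\<integral>y. (x \<bullet> y)\<^sup>2 \<partial>?D) \<le> v / s\<^sup>2 * (norm x)\<^sup>2" for x
  proof -
    have int: "integrable M (\<lambda>\<omega>. (Z \<omega> \<bullet> x)\<^sup>2)"
      using weak_variance[of x] by (intro integrableI_bounded) (auto intro: le_less_trans)
    have le: "expectation (\<lambda>\<omega>. (Z \<omega> \<bullet> x)\<^sup>2) \<le> v * (norm x)\<^sup>2"
      using weak_variance[of x] v_pos by (subst (asm) nn_integral_eq_integral[OF int]) auto
    have eq: "(x \<bullet> standardize z)\<^sup>2 = ((z \<bullet> x)\<^sup>2 - 2 * (?m \<bullet> x) * (z \<bullet> x) + (?m \<bullet> x)\<^sup>2) / s\<^sup>2" for z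
    proof -
      have "(x \<bullet> standardize z)\<^sup>2 = (z \<bullet> x - ?m \<bullet> x)\<^sup>2 / s\<^sup>2"
        by (simp add: standardize_def power_mult_distrib power_inverse divide_inverse inner_diff_right inner_commute)
      then show ?thesis by (simp add: power2_diff algebra_simps)
    qed
    have "(\<integral>y. (x \<bullet> y)\<^sup>2 \<partial>?D) = expectation (\<lambda>\<omega>. (x \<bullet> standardize (Z \<omega>))\<^sup>2)"
      by (rule integral_distr) measurable
    also have "\<dots> = (expectation (\<lambda>\<omega>. (Z \<omega> \<bullet> x)\<^sup>2) - (?m \<bullet> x)\<^sup>2) / s\<^sup>2"
      unfolding eq using int integrable_Z by (simp add: prob_space power2_eq_square[of "?m \<bullet> x"])
    also have "\<dots> \<le> v * (norm x)\<^sup>2 / s\<^sup>2"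
      using le by (intro divide_right_mono) (auto simp: diff_le_eq add_increasing2)
    finally show ?thesis by simp
  qed
  \<comment> \<open>As the mean has norm at most \<open>s\<close>,
    \<open>|z - E Z| <= 2 * max |z| s\<close>; the power of a maximum is at most the sum of the
    powers.\<close>
  have pw: "norm (standardize z) powr r \<le> 2 powr r / s powr r * (norm z powr r + s powr r)" for z
  proof -
    have "norm (standardize z) \<le> 2 * max (norm z) s / s"
    proof -
      have "norm (z - ?m) \<le> norm z + s"
        using norm_triangle_ineq4[of z ?m] norm_expectation_le by linarith
      also have "\<dots> \<le> 2 * max (norm z) s" by simp
      finally show ?thesis using s_pos by (simp add: standardize_def divide_right_mono divide_inverse_commute)
    qed
    then have "norm (standardize z) powr r \<le> (2 * max (norm z) s / s) powr r"
      using r_gt by (intro powr_mono2) auto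
    also have "\<dots> = 2 powr r / s powr r * max (norm z) s powr r"
      using s_pos by (simp add: powr_mult powr_divide)
    also have "\<dots> \<le> 2 powr r / s powr r * (norm z powr r + s powr r)"
      by (intro mult_left_mono) (auto simp: max_def)
    finally show ?thesis .
  qed
  have "(\<integral>\<^sup>+ y. ennreal (norm y powr r) \<partial>?D) = (\<integral>\<^sup>+ \<omega>. ennreal (norm (standardize (Z \<omega>)) powr r) \<partial>M)"
    by (rule nn_integral_distr) measurable
  also have "\<dots> \<le> (\<integral>\<^sup>+ \<omega>. ennreal (2 powr r / s powr r) * (ennreal (norm (Z \<omega>) powr r) + ennreal (s powr r)) \<partial>M)"
    using pw s_pos by (intro nn_integral_mono) (auto simp: ennreal_mult[symmetric] ennreal_plus[symmetric] simp del: ennreal_plus)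
  also have "\<dots> = ennreal (2 powr r / s powr r) * ((\<integral>\<^sup>+ \<omega>. ennreal (norm (Z \<omega>) powr r) \<partial>M) + ennreal (s powr r))"
    by (subst nn_integral_cmult, measurable, subst nn_integral_add, measurable)
      (simp add: emeasure_space_1)
  also have "\<dots> \<le> ennreal (2 powr r / s powr r) * (ennreal (c * s powr r) + ennreal (s powr r))"
    using moment by (intro mult_left_mono add_right_mono) auto
  also have "\<dots> = ennreal (2 powr r / s powr r * (c * s powr r + s powr r))"
    using c_nonneg by (simp add: ennreal_plus[symmetric] ennreal_mult[symmetric] del: ennreal_plus)
  also have "2 powr r / s powr r * (c * s powr r + s powr r) = 2 powr r * (c + 1)"
    using s_pos by (simp add: field_simps)
  finally show "(\<integral>\<^sup>+ y. ennreal (norm y powr r) \<partial>?D) \<le> ennreal (2 powr r * (c + 1))" .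
qed

text \<open>The same measurable map applied to each coordinate preserves both independence and
  equality of laws, so the joint law is the product on which the previous bounds are stated. The
  \<open>restrict\<close> is there because points of a product space are extensional
  functions.\<close>

lemma nn_integral_standardized_copies:
  assumes X: "independent_copies M n Z X" and n: "n > 0"
    and f: "f \<in> borel_measurable (PiM {1..n} (\<lambda>_. borel :: 'h measure))"
  shows "(\<integral>\<^sup>+ \<omega>. f (\<lambda>i\<in>{1..n}. standardize (X i \<omega>)) \<partial>M)
    = (\<integral>\<^sup>+ \<xi>. f \<xi> \<partial>PiM {1..n} (\<lambda>_. distr M borel (\<lambda>\<omega>. standardize (Z \<omega>))))"
proof -
  let ?V = "\<lambda>i \<omega>. standardize (X i \<omega>)"
  have indep: "indep_vars (\<lambda>_. borel) X {1..n}" and same: "\<And>i. i \<in> {1..n} \<Longrightarrow> distr M borel (X i) = distr M borel Z"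
    using X by (auto simp: independent_copies_def)
  have Xm: "X i \<in> borel_measurable M" if "i \<in> {1..n}" for i
    using indep that by (auto simp: indep_vars_def)
  have Vm: "?V i \<in> borel_measurable M" if "i \<in> {1..n}" for i
    using measurable_compose[OF Xm[OF that] measurable_standardize] .
  have "indep_vars (\<lambda>_. borel) ?V {1..n}"
    using indep by (rule indep_vars_compose2) (rule measurable_standardize)
  then have "distr M (PiM {1..n} (\<lambda>_. borel)) (\<lambda>\<omega>. \<lambda>i\<in>{1..n}. ?V i \<omega>)
      = PiM {1..n} (\<lambda>i. distr M borel (?V i))"
    using indep_vars_iff_distr_eq_PiM'[where I = "{1..n}" and M' = "\<lambda>_. borel" and X = ?V] n Vm by simp
  also have "\<dots> = PiM {1..n} (\<lambda>_. distr M borel (\<lambda>\<omega>. standardize (Z \<omega>)))"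
  proof (rule PiM_cong)
    fix i assume i: "i \<in> {1..n}"
    have "distr M borel (?V i) = distr (distr M borel (X i)) borel standardize"
      using Xm[OF i] by (simp add: distr_distr comp_def)
    also have "\<dots> = distr M borel (\<lambda>\<omega>. standardize (Z \<omega>))"
      unfolding same[OF i] by (simp add: distr_distr comp_def)
    finally show "distr M borel (?V i) = distr M borel (\<lambda>\<omega>. standardize (Z \<omega>))" .
  qed simp
  finally have eq: "distr M (PiM {1..n} (\<lambda>_. borel)) (\<lambda>\<omega>. \<lambda>i\<in>{1..n}. ?V i \<omega>)
      = PiM {1..n} (\<lambda>_. distr M borel (\<lambda>\<omega>. standardize (Z \<omega>)))" .
  have "(\<lambda>\<omega>. \<lambda>i\<in>{1..n}. ?V i \<omega>) \<in> measurable M (PiM {1..n} (\<lambda>_. borel))"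
    by (rule measurable_restrict) (rule Vm)
  from nn_integral_distr[OF this, of f] f show ?thesis unfolding eq by simp
qed

text \<open>The centred mean is \<open>s / n\<close> times the sum of the standardised copies, so
  the threshold \<open>12 * n\<close> becomes \<open>12 * s^2 / n\<close>. In the residual term the
  factor \<open>s^2\<close> cancels the denominator of \<open>v / s^2\<close>, leaving the summand
  of the second condition in (ii) with \<open>\<mu> = 1 / 4\<close>.\<close>

lemma nn_integral_centred_mean_excess:
  assumes X: "independent_copies M n Z X" and n: "n \<ge> 2" and \<kappa>: "\<kappa> \<ge> 12"
  shows "(\<integral>\<^sup>+ \<omega>. ennreal (max ((norm (centred_mean M n Z X \<omega>))\<^sup>2 - \<kappa> * s\<^sup>2 / real n) 0) \<partial>M)
    \<le> ennreal (32 / real n * (v * exp (- (1 / 4) * (s\<^sup>2 / v)))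
        + excess_const r (2 powr r * (c + 1)) * excess_rate r n * s\<^sup>2)"
proof -
  let ?V = "\<lambda>\<omega>. \<lambda>i\<in>{1..n}. standardize (X i \<omega>)"
  let ?f = "\<lambda>\<xi>::nat \<Rightarrow> 'h. ennreal (max ((norm (\<Sum>i=1..n. \<xi> i))\<^sup>2 - 12 * real n) 0)"
  let ?C = "excess_const r (2 powr r * (c + 1))"
  have np: "real n > 0" using n by simp
  have [measurable]: "?f \<in> borel_measurable (PiM {1..n} (\<lambda>_. borel))" by measurable
  have pw: "ennreal (max ((norm (centred_mean M n Z X \<omega>))\<^sup>2 - \<kappa> * s\<^sup>2 / real n) 0)
      \<le> ennreal (s\<^sup>2 / (real n)\<^sup>2) * ?f (?V \<omega>)" for \<omega>
  proof -
    let ?S = "\<Sum>i=1..n. ?V \<omega> i"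
    have "?S = (\<Sum>i=1..n. (X i \<omega> - expectation Z) /\<^sub>R s)"
      by (intro sum.cong) (auto simp: standardize_def)
    also have "\<dots> = (\<Sum>i=1..n. X i \<omega> - expectation Z) /\<^sub>R s"
      by (rule scaleR_sum_right[symmetric])
    finally have "centred_mean M n Z X \<omega> = (s / real n) *\<^sub>R ?S"
      using s_pos by (simp add: centred_mean_def)
    then have "(norm (centred_mean M n Z X \<omega>))\<^sup>2 = s\<^sup>2 / (real n)\<^sup>2 * (norm ?S)\<^sup>2"
      by (simp add: power_mult_distrib power_divide)
    moreover have "s\<^sup>2 / (real n)\<^sup>2 * (12 * real n) \<le> \<kappa> * s\<^sup>2 / real n"
      using np \<kappa> s_pos by (simp add: power2_eq_square field_simps)
    ultimately have "(norm (centred_mean M n Z X \<omega>))\<^sup>2 - \<kappa> * s\<^sup>2 / real n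
        \<le> s\<^sup>2 / (real n)\<^sup>2 * ((norm ?S)\<^sup>2 - 12 * real n)"
      unfolding right_diff_distrib by linarith
    also have "\<dots> \<le> s\<^sup>2 / (real n)\<^sup>2 * max ((norm ?S)\<^sup>2 - 12 * real n) 0"
      by (intro mult_left_mono) auto
    finally have "max ((norm (centred_mean M n Z X \<omega>))\<^sup>2 - \<kappa> * s\<^sup>2 / real n) 0
        \<le> s\<^sup>2 / (real n)\<^sup>2 * max ((norm ?S)\<^sup>2 - 12 * real n) 0" by simp
    from ennreal_leI[OF this] show ?thesis by (simp only: ennreal_mult' zero_le_divide_iff zero_le_power2 simp_thms)
  qed
  have Vm: "?V \<in> measurable M (PiM {1..n} (\<lambda>_. borel))"
  proof (rule measurable_restrict)
    fix i assume "i \<in> {1..n}"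
    then have [measurable]: "X i \<in> borel_measurable M"
      using X by (auto simp: independent_copies_def indep_vars_def)
    show "(\<lambda>\<omega>. standardize (X i \<omega>)) \<in> borel_measurable M" by measurable
  qed
  have "(\<integral>\<^sup>+ \<omega>. ennreal (max ((norm (centred_mean M n Z X \<omega>))\<^sup>2 - \<kappa> * s\<^sup>2 / real n) 0) \<partial>M)
      \<le> (\<integral>\<^sup>+ \<omega>. ennreal (s\<^sup>2 / (real n)\<^sup>2) * ?f (?V \<omega>) \<partial>M)"
    by (intro nn_integral_mono pw)
  also have "\<dots> = ennreal (s\<^sup>2 / (real n)\<^sup>2) * (\<integral>\<^sup>+ \<omega>. ?f (?V \<omega>) \<partial>M)"
    by (rule nn_integral_cmult) (rule measurable_compose[OF Vm], measurable)
  also have "(\<integral>\<^sup>+ \<omega>. ?f (?V \<omega>) \<partial>M)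
      = (\<integral>\<^sup>+ \<xi>. ?f \<xi> \<partial>PiM {1..n} (\<lambda>_. distr M borel (\<lambda>\<omega>. standardize (Z \<omega>))))"
    using n by (intro nn_integral_standardized_copies X) auto
  also have "ennreal (s\<^sup>2 / (real n)\<^sup>2) * \<dots> \<le> ennreal (s\<^sup>2 / (real n)\<^sup>2) *
      ennreal ((real n)\<^sup>2 * (?C * excess_rate r n) + 32 * (v / s\<^sup>2) * real n * exp (- 1 / (4 * (v / s\<^sup>2))))"
    by (intro mult_left_mono std.excess_bound n) simp
  also have "\<dots> = ennreal (s\<^sup>2 / (real n)\<^sup>2 *
      ((real n)\<^sup>2 * (?C * excess_rate r n) + 32 * (v / s\<^sup>2) * real n * exp (- 1 / (4 * (v / s\<^sup>2)))))"
    by (rule ennreal_mult'[symmetric]) simp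
  also have "s\<^sup>2 / (real n)\<^sup>2 *
      ((real n)\<^sup>2 * (?C * excess_rate r n) + 32 * (v / s\<^sup>2) * real n * exp (- 1 / (4 * (v / s\<^sup>2))))
    = 32 / real n * (v * exp (- (1 / 4) * (s\<^sup>2 / v))) + ?C * excess_rate r n * s\<^sup>2"
    using s_pos v_pos np by (simp add: field_simps power2_eq_square)
  finally show ?thesis .
qed

end

section \<open>Supremum over the index set and conclusion\<close>

lemma measurable_centred_mean:
  assumes M: "prob_space M" and X: "independent_copies M n Z X"
  shows "centred_mean M n Z X \<in> borel_measurable M"
proof -
  have [measurable]: "X i \<in> borel_measurable M" if "i \<in> {1..n}" for i
    using X that by (auto simp: independent_copies_def prob_space.indep_vars_def[OF M])
  show ?thesis unfolding centred_mean_def by measurable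
qed

text \<open>The supremum may be replaced by the sum without loss for the final rate, since condition
  (ii) controls sums over the index set.\<close>

lemma expected_sup_excess_le_sum:
  assumes A: "finite A" and meas: "\<And>l. l \<in> A \<Longrightarrow> U l \<in> borel_measurable M"
  shows "expected_sup_excess M A U t
    \<le> (\<Sum>l\<in>A. \<integral>\<^sup>+ \<omega>. ennreal (max ((norm (U l \<omega>))\<^sup>2 - t l) 0) \<partial>M)"
proof -
  have "expected_sup_excess M A U t
      \<le> (\<integral>\<^sup>+ \<omega>. (\<Sum>l\<in>A. ennreal (max ((norm (U l \<omega>))\<^sup>2 - t l) 0)) \<partial>M)"
    unfolding expected_sup_excess_def using A
    by (intro nn_integral_mono SUP_least member_le_sum) auto
  also have "\<dots> = (\<Sum>l\<in>A. \<integral>\<^sup>+ \<omega>. ennreal (max ((norm (U l \<omega>))\<^sup>2 - t l) 0) \<partial>M)"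
  proof (rule nn_integral_sum)
    fix l assume "l \<in> A"
    then have [measurable]: "U l \<in> borel_measurable M" by (rule meas)
    show "(\<lambda>\<omega>. ennreal (max ((norm (U l \<omega>))\<^sup>2 - t l) 0)) \<in> borel_measurable M" by measurable
  qed
  finally show ?thesis .
qed

theorem propositionB5:
  fixes S0 :: "'h::{real_inner, banach, second_countable_topology} set"
    and M :: "nat \<Rightarrow> 'a measure"
    and Lam :: "nat \<Rightarrow> 'l set"
    and Z :: "nat \<Rightarrow> 'l \<Rightarrow> 'a \<Rightarrow> 'h"
    and X :: "nat \<Rightarrow> 'l \<Rightarrow> nat \<Rightarrow> 'a \<Rightarrow> 'h"
    and U :: "nat \<Rightarrow> 'l \<Rightarrow> 'a \<Rightarrow> 'h"
    and s v :: "nat \<Rightarrow> 'l \<Rightarrow> real"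
    and L :: "nat \<Rightarrow> real"
    and r0 C_r0 :: real
  assumes S0: "countable S0" "\<forall>\<psi>\<in>S0. - \<psi> \<in> S0" "S0 \<subseteq> sphere 0 1" "sphere 0 1 \<subseteq> closure S0"
    and prob: "\<forall>N\<ge>2. prob_space (M N)"
    and Lam: "\<forall>N\<ge>2. finite (Lam N)"
    and Z: "\<forall>N\<ge>2. \<forall>l\<in>Lam N. Z N l \<in> borel_measurable (M N)"
    and X: "\<forall>N\<ge>2. \<forall>l\<in>Lam N. independent_copies (M N) N (Z N l) (X N l)"
    and U: "\<forall>N\<ge>2. \<forall>l\<in>Lam N. U N l = centred_mean (M N) N (Z N l) (X N l)"
    and r0: "r0 > 2"
    and sv_pos: "\<forall>N\<ge>2. \<forall>l\<in>Lam N. s N l > 0 \<and> v N l > 0"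
    and second_moment:
      "\<forall>N\<ge>2. \<forall>l\<in>Lam N. (\<integral>\<^sup>+ \<omega>. ennreal ((norm (Z N l \<omega>))\<^sup>2) \<partial>M N) \<le> ennreal ((s N l)\<^sup>2)"
    and weak_variance:
      "\<forall>N\<ge>2. \<forall>l\<in>Lam N.
         (SUP \<psi>\<in>S0. \<integral>\<^sup>+ \<omega>. ennreal ((Z N l \<omega> \<bullet> \<psi>)\<^sup>2) \<partial>M N) \<le> ennreal (v N l)"
    and moment_r0:
      "\<forall>N\<ge>2. \<forall>l\<in>Lam N.
         (\<integral>\<^sup>+ \<omega>. ennreal (norm (Z N l \<omega>) powr r0) \<partial>M N) \<le> ennreal (C_r0 * s N l powr r0)"
    and L: "\<forall>N\<ge>2. L N > 0" "\<forall>N\<ge>2. (\<Sum>l\<in>Lam N. (s N l)\<^sup>2) \<le> L N"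
  shows
    "((\<forall>\<mu>>0. \<exists>C_V::real. \<forall>N\<ge>2.
          (\<Sum>l\<in>Lam N. v N l * exp (- \<mu> * ((s N l)\<^sup>2 / v N l))) \<le> C_V) \<longrightarrow>
        (\<forall>\<kappa>\<ge>12. \<exists>C\<ge>0. \<forall>N\<ge>2.
          expected_sup_excess (M N) (Lam N) (U N) (\<lambda>l. \<kappa> * (s N l)\<^sup>2 / real N)
            \<le> ennreal (C * (1 / real N
                 + L N * ln (real N) powr (r0 - 2) / real N powr ((r0 - 2) / 2)))))
     \<and> ((\<exists>v0::real. \<forall>N\<ge>2. \<forall>l\<in>Lam N. v N l \<le> v0) \<and>
        (\<forall>\<mu>>0. \<exists>C_V'::real. \<forall>N\<ge>2. (\<Sum>l\<in>Lam N. exp (- \<mu> * (s N l)\<^sup>2)) \<le> C_V') \<longrightarrow>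
        (\<forall>\<kappa>\<ge>12. \<exists>C\<ge>0. \<forall>N\<ge>2.
          expected_sup_excess (M N) (Lam N) (U N) (\<lambda>l. \<kappa> * (s N l)\<^sup>2 / real N)
            \<le> ennreal (C * (1 / real N
                 + L N * ln (real N) powr (r0 - 2) / real N powr ((r0 - 2) / 2)))))"
proof -
  \<comment> \<open>The sign of \<open>C_r0\<close> is not assumed, whereas the locale asks for a
    nonnegative constant.\<close>
  define c where "c = max C_r0 0"
  define K where "K = excess_const r0 (2 powr r0 * (c + 1))"
  have K0: "K \<ge> 0" by (auto simp: K_def c_def excess_const_def)
  have each: "(\<integral>\<^sup>+ \<omega>. ennreal (max ((norm (U N l \<omega>))\<^sup>2 - \<kappa> * (s N l)\<^sup>2 / real N) 0) \<partial>M N)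
      \<le> ennreal (32 / real N * (v N l * exp (- (1 / 4) * ((s N l)\<^sup>2 / v N l)))
          + K * excess_rate r0 N * (s N l)\<^sup>2)"
    if N: "N \<ge> 2" and l: "l \<in> Lam N" and \<kappa>: "\<kappa> \<ge> 12" for N l \<kappa>
  proof -
    interpret prob_space "M N" using prob N by simp
    interpret hilbert_random_element "M N" "Z N l" "s N l" "v N l" r0 c
    proof
      show "Z N l \<in> borel_measurable (M N)" "s N l > 0" "v N l > 0" "r0 > 2" "c \<ge> 0"
        "(\<integral>\<^sup>+ \<omega>. ennreal ((norm (Z N l \<omega>))\<^sup>2) \<partial>M N) \<le> ennreal ((s N l)\<^sup>2)"
        using Z sv_pos r0 second_moment N l by (auto simp: c_def)
      \<comment> \<open>The weak variance is assumed on \<open>S0\<close> only; density of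
        \<open>S0\<close> in the sphere extends it to every direction.\<close>
      then show "(\<integral>\<^sup>+ \<omega>. ennreal ((Z N l \<omega> \<bullet> x)\<^sup>2) \<partial>M N) \<le> ennreal (v N l * (norm x)\<^sup>2)" for x
        using weak_variance N l
        by (intro nn_integral_inner_sq_le_of_dense[OF _ S0(4)]) (auto simp: SUP_le_iff)
      have "(\<integral>\<^sup>+ \<omega>. ennreal (norm (Z N l \<omega>) powr r0) \<partial>M N) \<le> ennreal (C_r0 * s N l powr r0)"
        using moment_r0 N l by simp
      also have "\<dots> \<le> ennreal (c * s N l powr r0)"
        by (intro ennreal_leI mult_right_mono) (auto simp: c_def)
      finally show "(\<integral>\<^sup>+ \<omega>. ennreal (norm (Z N l \<omega>) powr r0) \<partial>M N) \<le> ennreal (c * s N l powr r0)" .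
    qed
    show ?thesis
      using nn_integral_centred_mean_excess[OF _ N \<kappa>, of "X N l"] X U N l by (simp add: K_def)
  qed
  \<comment> \<open>Both alternatives of the theorem are reduced to the exponential sum at
    \<open>\<mu> = 1 / 4\<close>.\<close>
  have main: "\<exists>C\<ge>0. \<forall>N\<ge>2.
          expected_sup_excess (M N) (Lam N) (U N) (\<lambda>l. \<kappa> * (s N l)\<^sup>2 / real N)
            \<le> ennreal (C * (1 / real N
                 + L N * ln (real N) powr (r0 - 2) / real N powr ((r0 - 2) / 2)))"
    if CV: "\<And>N. N \<ge> 2 \<Longrightarrow> (\<Sum>l\<in>Lam N. v N l * exp (- (1 / 4) * ((s N l)\<^sup>2 / v N l))) \<le> CV"
      and \<kappa>: "\<kappa> \<ge> 12" for CV \<kappa>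
  proof (intro exI[of _ "32 * max CV 0 + K"] conjI allI impI)
    show "0 \<le> 32 * max CV 0 + K" using K0 by simp
    fix N :: nat assume N: "N \<ge> 2"
    let ?e = "\<lambda>l. v N l * exp (- (1 / 4) * ((s N l)\<^sup>2 / v N l))"
    have np: "real N > 0" using N by simp
    have rate0: "excess_rate r0 N \<ge> 0" by (simp add: excess_rate_def)
    have "expected_sup_excess (M N) (Lam N) (U N) (\<lambda>l. \<kappa> * (s N l)\<^sup>2 / real N)
        \<le> (\<Sum>l\<in>Lam N. \<integral>\<^sup>+ \<omega>. ennreal (max ((norm (U N l \<omega>))\<^sup>2 - \<kappa> * (s N l)\<^sup>2 / real N) 0) \<partial>M N)"
      using Lam U X N prob by (intro expected_sup_excess_le_sum) (auto intro: measurable_centred_mean)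
    also have "\<dots> \<le> (\<Sum>l\<in>Lam N. ennreal (32 / real N * ?e l + K * excess_rate r0 N * (s N l)\<^sup>2))"
      using each[OF N _ \<kappa>] by (intro sum_mono) auto
    also have "\<dots> = ennreal (\<Sum>l\<in>Lam N. 32 / real N * ?e l + K * excess_rate r0 N * (s N l)\<^sup>2)"
      using sv_pos N K0 rate0
      by (intro sum_ennreal add_nonneg_nonneg mult_nonneg_nonneg) (auto simp: less_imp_le)
    also have "(\<Sum>l\<in>Lam N. 32 / real N * ?e l + K * excess_rate r0 N * (s N l)\<^sup>2)
        = 32 / real N * (\<Sum>l\<in>Lam N. ?e l) + K * excess_rate r0 N * (\<Sum>l\<in>Lam N. (s N l)\<^sup>2)"
      by (simp only: sum.distrib sum_distrib_left)
    also have "\<dots> \<le> 32 / real N * max CV 0 + K * excess_rate r0 N * L N"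
      using CV[OF N] L(2) N np K0 rate0 by (intro add_mono mult_left_mono) auto
    \<comment> \<open>The product on the right contains both terms of the left side; the two
      remaining cross terms are nonnegative.\<close>
    also have "\<dots> \<le> (32 * max CV 0 + K) * (1 / real N + L N * excess_rate r0 N)"
    proof -
      have "0 \<le> K / real N + 32 * max CV 0 * (L N * excess_rate r0 N)"
        using K0 np rate0 L(1) N by (intro add_nonneg_nonneg mult_nonneg_nonneg) (auto simp: less_imp_le)
      then show ?thesis by (simp add: algebra_simps)
    qed
    finally show "expected_sup_excess (M N) (Lam N) (U N) (\<lambda>l. \<kappa> * (s N l)\<^sup>2 / real N)
        \<le> ennreal ((32 * max CV 0 + K) * (1 / real N
                 + L N * ln (real N) powr (r0 - 2) / real N powr ((r0 - 2) / 2)))"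
      by (simp add: excess_rate_def ennreal_leI)
  qed
  show ?thesis
  proof (intro conjI impI allI)
    fix \<kappa> :: real
    assume "\<forall>\<mu>>0. \<exists>C_V::real. \<forall>N\<ge>2. (\<Sum>l\<in>Lam N. v N l * exp (- \<mu> * ((s N l)\<^sup>2 / v N l))) \<le> C_V"
      and \<kappa>: "\<kappa> \<ge> 12"
    then obtain CV where "\<forall>N\<ge>2. (\<Sum>l\<in>Lam N. v N l * exp (- (1 / 4) * ((s N l)\<^sup>2 / v N l))) \<le> CV"
      by (meson zero_less_divide_1_iff zero_less_numeral)
    then show "\<exists>C\<ge>0. \<forall>N\<ge>2.
          expected_sup_excess (M N) (Lam N) (U N) (\<lambda>l. \<kappa> * (s N l)\<^sup>2 / real N)
            \<le> ennreal (C * (1 / real N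
                 + L N * ln (real N) powr (r0 - 2) / real N powr ((r0 - 2) / 2)))"
      by (intro main[OF _ \<kappa>]) auto
  next
    fix \<kappa> :: real
    assume *: "(\<exists>v0::real. \<forall>N\<ge>2. \<forall>l\<in>Lam N. v N l \<le> v0) \<and>
        (\<forall>\<mu>>0. \<exists>C_V'::real. \<forall>N\<ge>2. (\<Sum>l\<in>Lam N. exp (- \<mu> * (s N l)\<^sup>2)) \<le> C_V')"
      and \<kappa>: "\<kappa> \<ge> 12"
    from * obtain v1 where v1: "\<And>N l. N \<ge> 2 \<Longrightarrow> l \<in> Lam N \<Longrightarrow> v N l \<le> v1" by blast
    \<comment> \<open>The maximum with 1 makes the bound positive. As \<open>v <= v0\<close> gives
      \<open>s^2 / v >= s^2 / v0\<close>, the assumption at \<open>\<mu> = 1 / (4 * v0)\<close>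
      yields the required sum, with bound \<open>v0 * CV\<close>.\<close>
    define v0 where "v0 = max v1 1"
    have v0: "v0 > 0" "\<And>N l. N \<ge> 2 \<Longrightarrow> l \<in> Lam N \<Longrightarrow> v N l \<le> v0"
      using v1 by (auto simp: v0_def le_max_iff_disj)
    have "1 / (4 * v0) > 0" using v0 by simp
    with * obtain CV where CV: "\<And>N. N \<ge> 2 \<Longrightarrow> (\<Sum>l\<in>Lam N. exp (- (1 / (4 * v0)) * (s N l)\<^sup>2)) \<le> CV"
      by blast
    show "\<exists>C\<ge>0. \<forall>N\<ge>2.
          expected_sup_excess (M N) (Lam N) (U N) (\<lambda>l. \<kappa> * (s N l)\<^sup>2 / real N)
            \<le> ennreal (C * (1 / real N
                 + L N * ln (real N) powr (r0 - 2) / real N powr ((r0 - 2) / 2)))"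
    proof (rule main[OF _ \<kappa>])
      fix N :: nat assume N: "N \<ge> 2"
      have "(\<Sum>l\<in>Lam N. v N l * exp (- (1 / 4) * ((s N l)\<^sup>2 / v N l)))
          \<le> (\<Sum>l\<in>Lam N. v0 * exp (- (1 / (4 * v0)) * (s N l)\<^sup>2))"
      proof (intro sum_mono mult_mono)
        fix l assume l: "l \<in> Lam N"
        have v: "0 < v N l" "v N l \<le> v0" using sv_pos v0 N l by auto
        then have "(s N l)\<^sup>2 / v0 \<le> (s N l)\<^sup>2 / v N l" using v0 by (intro divide_left_mono) auto
        then show "exp (- (1 / 4) * ((s N l)\<^sup>2 / v N l)) \<le> exp (- (1 / (4 * v0)) * (s N l)\<^sup>2)"
          by simp
      qed (use v0 N in auto)
      also have "\<dots> \<le> v0 * CV"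
        using CV[OF N] v0(1) by (simp add: sum_distrib_left[symmetric])
      finally show "(\<Sum>l\<in>Lam N. v N l * exp (- (1 / 4) * ((s N l)\<^sup>2 / v N l))) \<le> v0 * CV" .
    qed
  qed
qed

end
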